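(* Let $R(\lambda)\in\mathbb{C}(\lambda)^{m\times n}$ be a nonzero rational matrix of normal rank $r$, let $\lambda_0\in\mathbb{C}$, let $\ell\ge 0$ be the order of $\lambda_0$ as a pole of $R(\lambda)$ ($\ell=0$ if $\lambda_0$ is not a pole), let $\sigma_1\le\dots\le\sigma_r$ be the structural indices of $R(\lambda)$ at $\lambda_0$, put $d':=\max_i\sigma_i$, and for each integer $k$ let $e_k:=\#\{j:\sigma_j=k\}$. Apply the Toeplitz rank search described in the context to $\widehat R(\lambda):=(\lambda-\lambda_0)^{\ell}R(\lambda)$ with $\delta:=d'+\ell$, obtaining $N(\lambda)\in\mathbb{C}[\lambda]^{n\times n}$, $\widehat R^{(\delta)}(\lambda)$ and $L_0^{(\delta)}$. Put $N_r(\lambda):=N(\lambda)\begin{bmatrix}I_r\\0\end{bmatrix}$ and $\hat M_r(\lambda):=\widehat R^{(\delta)}(\lambda)\begin{bmatrix}I_r\\0\end{bmatrix}$. Then $$R(\lambda)N_r(\lambda)=\hat M_r(\lambda)\Lambda_{(r)}(\lambda),\qquad \Lambda_{(r)}(\lambda)=\operatorname{diag}\bigl((\lambda-\lambda_0)^{-\ell}I_{e_{-\ell}},\dots,(\lambda-\lambda_0)^{d'}I_{e_{d'}}\bigr),$$ where $N(\lambda)$ is unimodular (so $N_r(\lambda)$ is a submatrix of a unimodular matrix), $\hat M_r(\lambda)$ is a rational matrix with no pole at $\lambda_0$, and the constant matrix $\hat M_r(\lambda_0)=L_0^{(\delta)}$ has full rank $r$.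
   Context: The normal rank of a matrix over $\mathbb{C}(\lambda)$ is its rank over the field $\mathbb{C}(\lambda)$. A square polynomial matrix is unimodular if its determinant is a nonzero constant. The structural indices of an $m\times n$ rational matrix $R(\lambda)$ of normal rank $r$ at $\lambda_0\in\mathbb{C}$ are the uniquely determined integers $\sigma_1\le\dots\le\sigma_r$ such that $M(\lambda)R(\lambda)N(\lambda)=\operatorname{diag}((\lambda-\lambda_0)^{\sigma_1},\dots,(\lambda-\lambda_0)^{\sigma_r})\oplus 0_{(m-r)\times(n-r)}$ for some square rational matrices $M(\lambda),N(\lambda)$ having no pole at $\lambda_0$ and with $M(\lambda_0),N(\lambda_0)$ invertible. Toeplitz rank search at $\lambda_0$ for a rational matrix $\widehat R(\lambda)\in\mathbb{C}(\lambda)^{m\times n}$ without pole at $\lambda_0$, with last step $\delta\ge0$. Put $\widehat R^{(-1)}:=\widehat R$, $\rho_{-1}:=0$, $\nu_{-1}:=n$. For $i=0,1,\dots,\delta$, given a rational matrix $\widehat R^{(i-1)}(\lambda)$ without pole at $\lambda_0$ and integers $\rho_{i-1}$, $\nu_{i-1}=n-\rho_{i-1}$ such that the first $\rho_{i-1}$ columns of $\widehat R^{(i-1)}(\lambda_0)$ are linearly independent, do the following. (1) Partition $\widehat R^{(i-1)}(\lambda_0)=\begin{bmatrix}L_0^{(i-1)} & R_1^{(i-1)}\end{bmatrix}$ with $L_0^{(i-1)}\in\mathbb{C}^{m\times\rho_{i-1}}$ and $R_1^{(i-1)}\in\mathbb{C}^{m\times\nu_{i-1}}$. (2) Let $Z_i:=-\bigl(L_0^{(i-1)}\bigr)^{\dagger}R_1^{(i-1)}$,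 where $\dagger$ is the Moore–Penrose inverse, and let $Q_i\in\mathbb{C}^{\nu_{i-1}\times\nu_{i-1}}$ be a unitary matrix such that $\bigl(I_m-L_0^{(i-1)}(L_0^{(i-1)})^{\dagger}\bigr)R_1^{(i-1)}Q_i=\begin{bmatrix}L_{0+}^{(i-1)} & 0\end{bmatrix}$ with $L_{0+}^{(i-1)}$ of full column rank (if the columns of $R_1^{(i-1)}$ lie in the column span of $L_0^{(i-1)}$, take $Q_i=I_{\nu_{i-1}}$). Set $N_i:=\begin{bmatrix} I_{\rho_{i-1}} & Z_iQ_i\\ 0& Q_i\end{bmatrix}$, so that $\widehat R^{(i-1)}(\lambda_0)N_i=\begin{bmatrix}L_0^{(i)} & 0\end{bmatrix}$ with $L_0^{(i)}:=\begin{bmatrix}L_0^{(i-1)} & L_{0+}^{(i-1)}\end{bmatrix}$ of full column rank. Let $\rho_i$ be the number of columns of $L_0^{(i)}$ and $\nu_i:=n-\rho_i$. (3) If $i<\delta$, let $\Lambda_i(\lambda):=\operatorname{diag}(I_{\rho_i},(\lambda-\lambda_0)I_{\nu_i})$ and $\widehat R^{(i)}(\lambda):=\widehat R^{(i-1)}(\lambda)N_i\Lambda_i(\lambda)^{-1}$. In the last step $i=\delta$, set $\Lambda_\delta:=I_n$ and $\widehat R^{(\delta)}(\lambda):=\widehat R^{(\delta-1)}(\lambda)N_\delta$. The output is $L_0^{(\delta)}$, $\widehat R^{(\delta)}(\lambda)$ and $N(\lambda):=N_0\Lambda_0^{-1}N_1\Lambda_1^{-1}\cdots N_{\delta}\Lambda_{\delta}^{-1}\,\Lambda_0\Lambda_1\cdots\Lambda_\delta$.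 *)

theory Defs
  imports
    "HOL-Computational_Algebra.Computational_Algebra"
    "HOL-Computational_Algebra.Field_as_Ring"
    "Jordan_Normal_Form.Schur_Decomposition"
    "Jordan_Normal_Form.DL_Rank"
begin

text \<open>
  Rational functions in one complex variable are the elements of the field
  \<^typ>\<open>complex poly fract\<close>; \<^const>\<open>quot_of_fract\<close> returns the fraction in lowest terms.
\<close>

type_synonym ratfun = "complex poly fract"

definition no_pole_at :: "complex \<Rightarrow> ratfun \<Rightarrow> bool" where
  "no_pole_at z f \<longleftrightarrow> poly (snd (quot_of_fract f)) z \<noteq> 0"

definition pole_order :: "complex \<Rightarrow> ratfun \<Rightarrow> nat" where
  "pole_order z f = Polynomial.order z (snd (quot_of_fract f))"

text \<open>Meaningful only when \<open>f\<close> has no pole at \<open>z\<close>.\<close>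

definition ratfun_eval :: "complex \<Rightarrow> ratfun \<Rightarrow> complex" where
  "ratfun_eval z f = poly (fst (quot_of_fract f)) z / poly (snd (quot_of_fract f)) z"

definition shifted_var :: "complex \<Rightarrow> ratfun" where
  "shifted_var z = to_fract [:- z, 1:]"

definition no_pole_mat :: "complex \<Rightarrow> ratfun mat \<Rightarrow> bool" where
  "no_pole_mat z R \<longleftrightarrow> (\<forall>f \<in> elements_mat R. no_pole_at z f)"

text \<open>Used only for matrices with at least one entry.\<close>

definition pole_order_mat :: "complex \<Rightarrow> ratfun mat \<Rightarrow> nat" where
  "pole_order_mat z R = Max (pole_order z ` elements_mat R)"

definition eval_mat :: "complex \<Rightarrow> ratfun mat \<Rightarrow> complex mat" where
  "eval_mat z = map_mat (ratfun_eval z)"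

definition const_mat :: "complex mat \<Rightarrow> ratfun mat" where
  "const_mat = map_mat (\<lambda>c. to_fract [:c:])"

definition mat_rank :: "'a :: field mat \<Rightarrow> nat" where
  "mat_rank A = vec_space.rank (dim_row A) A"

definition unimodular :: "complex poly mat \<Rightarrow> bool" where
  "unimodular P \<longleftrightarrow> square_mat P \<and> (\<exists>c. c \<noteq> 0 \<and> det P = [:c:])"

definition structural_indices :: "complex \<Rightarrow> ratfun mat \<Rightarrow> int list \<Rightarrow> bool" where
  "structural_indices z R \<sigma> \<longleftrightarrow>
     (let m = dim_row R; n = dim_col R; r = mat_rank R in
       sorted \<sigma> \<and> length \<sigma> = r \<and>
       (\<exists>M N. M \<in> carrier_mat m m \<and> N \<in> carrier_mat n n \<and>
          no_pole_mat z M \<and> no_pole_mat z N \<and>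
          invertible_mat (eval_mat z M) \<and> invertible_mat (eval_mat z N) \<and>
          M * R * N = diag_block_mat
            [mat_diag r (\<lambda>i. shifted_var z powi (\<sigma> ! i)), 0\<^sub>m (m - r) (n - r)]))"

definition is_moore_penrose :: "complex mat \<Rightarrow> complex mat \<Rightarrow> bool" where
  "is_moore_penrose A X \<longleftrightarrow>
     X \<in> carrier_mat (dim_col A) (dim_row A) \<and>
     A * X * A = A \<and> X * A * X = X \<and>
     mat_adjoint (A * X) = A * X \<and> mat_adjoint (X * A) = X * A"

definition moore_penrose :: "complex mat \<Rightarrow> complex mat" where
  "moore_penrose A = (THE X. is_moore_penrose A X)"

definition unitary_mat :: "complex mat \<Rightarrow> bool" where
  "unitary_mat Q \<longleftrightarrow> square_mat Q \<and>
     mat_adjoint Q * Q = 1\<^sub>m (dim_row Q) \<and> Q * mat_adjoint Q = 1\<^sub>m (dim_row Q)"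

definition append_cols :: "'a :: zero mat \<Rightarrow> 'a mat \<Rightarrow> 'a mat" (infixr \<open>@\<^sub>c\<close> 65) where
  "A @\<^sub>c B = four_block_mat A B (0\<^sub>m 0 (dim_col A)) (0\<^sub>m 0 (dim_col B))"

text \<open>
  One step of the search. Here \<open>A\<close> is the value at the point of the current rational matrix and
  \<open>\<rho>\<close> the current number of independent leading columns. The unitary \<open>Q\<close> is not determined by the
  data, so a step is a relation between its input and the pair \<open>N\<close>, \<open>L\<close>; the new \<open>\<rho>\<close> is
  \<open>dim_col L\<close>.
\<close>

definition toeplitz_step ::
  "complex mat \<Rightarrow> nat \<Rightarrow> complex mat \<Rightarrow> complex mat \<Rightarrow> bool" where
  "toeplitz_step A \<rho> N L \<longleftrightarrow>
     (let m = dim_row A; \<nu> = dim_col A - \<rho>;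
          (L0, R1, _, _) = split_block A m \<rho>;
          Z = - (moore_penrose L0 * R1)
      in \<exists>Q k Lplus.
           Q \<in> carrier_mat \<nu> \<nu> \<and> unitary_mat Q \<and>
           (set (cols R1) \<subseteq> vec_space.col_space m L0 \<longrightarrow> Q = 1\<^sub>m \<nu>) \<and>
           k \<le> \<nu> \<and> Lplus \<in> carrier_mat m k \<and> mat_rank Lplus = k \<and>
           (1\<^sub>m m - L0 * moore_penrose L0) * R1 * Q = Lplus @\<^sub>c 0\<^sub>m m (\<nu> - k) \<and>
           N = four_block_mat (1\<^sub>m \<rho>) (Z * Q) (0\<^sub>m \<nu> \<rho>) Q \<and>
           L = L0 @\<^sub>c Lplus)"

definition lead_one_diag :: "nat \<Rightarrow> nat \<Rightarrow> ratfun \<Rightarrow> ratfun mat" where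
  "lead_one_diag n \<rho> x = mat_diag n (\<lambda>j. if j < \<rho> then 1 else x)"

definition mat_prod :: "nat \<Rightarrow> 'a :: semiring_1 mat list \<Rightarrow> 'a mat" where
  "mat_prod n As = foldr (*) As (1\<^sub>m n)"

text \<open>
  \<open>toeplitz_rank_search z \<delta> Rhat Nout Rout Lout\<close>: some run of the search at \<open>z\<close> with last step \<open>\<delta>\<close>
  on \<open>Rhat\<close> outputs these three matrices. In the sequences below, index \<open>i\<close> holds the result of
  step \<open>i\<close>; \<^const>\<open>case_nat\<close> supplies the initial values belonging to index \<open>-1\<close>. The assignment
  \<open>x i = 1\<close> for the last step makes \<open>\<Lambda> \<delta>\<close> the identity.
\<close>

definition toeplitz_rank_search ::
  "complex \<Rightarrow> nat \<Rightarrow> ratfun mat \<Rightarrow> ratfun mat \<Rightarrow> ratfun mat \<Rightarrow> complex mat \<Rightarrow> bool" where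
  "toeplitz_rank_search z \<delta> Rhat Nout Rout Lout \<longleftrightarrow>
     (\<exists>(RR :: nat \<Rightarrow> ratfun mat) (N :: nat \<Rightarrow> complex mat) (L :: nat \<Rightarrow> complex mat).
       (let n = dim_col Rhat;
            \<rho> = (\<lambda>i. dim_col (L i));
            x = (\<lambda>i. if i < \<delta> then shifted_var z else 1);
            \<Lambda> = (\<lambda>i. lead_one_diag n (\<rho> i) (x i));
            \<Lambda>inv = (\<lambda>i. lead_one_diag n (\<rho> i) (inverse (x i)))
        in (\<forall>i \<le> \<delta>.
              toeplitz_step (eval_mat z (case_nat Rhat RR i)) (case_nat 0 \<rho> i) (N i) (L i) \<and>
              RR i = case_nat Rhat RR i * const_mat (N i) * \<Lambda>inv i) \<and>
           Nout = mat_prod n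
             (map (\<lambda>i. const_mat (N i) * \<Lambda>inv i) [0..<Suc \<delta>] @ map \<Lambda> [0..<Suc \<delta>]) \<and>
           Rout = RR \<delta> \<and>
           Lout = L \<delta>))"

text \<open>The \<open>n \<times> r\<close> matrix consisting of the first \<open>r\<close> columns of the identity.\<close>

definition lead_cols :: "nat \<Rightarrow> nat \<Rightarrow> 'a :: zero_neq_one mat" where
  "lead_cols n r = 1\<^sub>m r @\<^sub>r 0\<^sub>m (n - r) r"

end

theory Submission
  imports Defs
begin

text \<open>
  Write \<open>x = \<lambda> - \<lambda>\<^sub>0\<close> and \<open>S = x\<^sup>l R\<close>. At step \<open>i\<close> the matrix \<open>B\<close> obtained by multiplying with \<open>N\<^sub>i\<close>
  satisfies \<open>S U = B D\<close> with \<open>U\<close> unimodular and \<open>D = diag(x\<^sup>c)\<close>, where \<open>c\<^sub>j \<le> i\<close> for all columns and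
  \<open>c\<^sub>j = i\<close> for the columns not selected in an earlier step. Hence the values \<open>v(\<lambda>\<^sub>0)\<close> of the
  pole-free vectors \<open>v\<close> for which \<open>x\<^sup>i v\<close> is a pole-free combination of the columns of \<open>S\<close> are
  exactly the column span of the current \<open>L\<^sub>0\<close>. By the local Smith form they make up a space of
  dimension \<open>#{j. \<sigma>\<^sub>j + l \<le> i}\<close>, which is therefore the number of columns of \<open>L\<^sub>0\<close> after step \<open>i\<close>.
  So column \<open>j\<close> is divided by \<open>x\<close> exactly \<open>\<sigma>\<^sub>j + l\<close> times.
\<close>

text \<open>The unitary factors are free, so the number of selected columns must be tied to data
  that no choice affects; the span named above is such data. Two reasons remain to be given.
  \<open>U\<close> stays unimodular: the first \<rho> columns of \<open>N_i\<close> are unit vectors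
  and every other column carries the largest exponent \<open>i\<close>. So a nonzero entry at (a, b)
  forces \<open>c_a \<le> c_b\<close>, and \<open>D^-1 N_i D\<close> has polynomial entries and the
  determinant of \<open>N_i\<close>. The span is that of \<open>L_0\<close>: from
  \<open>x^i v = S w\<close> and \<open>S U = B D\<close> one gets \<open>v = B y\<close> with
  \<open>y_j = x^(c_j - i) (U^-1 w)_j\<close>. Only columns selected earlier can have
  \<open>c_j < i\<close>, so only those entries of \<open>y\<close> can have a pole. The
  corresponding columns of \<open>B\<close> are independent at the point, so such a pole could not
  cancel in \<open>B y\<close>; hence \<open>y\<close> is pole-free and \<open>v\<close> takes the
  value \<open>B y\<close> there. Conversely, \<open>x^i\<close> times column \<open>j\<close> of
  \<open>B\<close> is \<open>x^(i - c_j)\<close> times column \<open>j\<close> of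
  \<open>S U\<close>. The cancellation argument is the core: the value of \<open>B\<close> as a
  whole need not be injective.\<close>

no_notation fps_nth (infixl "$" 75)

subsection \<open>Rational functions without a pole\<close>

lemma no_pole_atE:
  assumes "no_pole_at z f"
  obtains p q where "poly q z \<noteq> 0" "f = to_fract p / to_fract q" "ratfun_eval z f = poly p z / poly q z"
  using that[of "snd (quot_of_fract f)" "fst (quot_of_fract f)"] assms
  by (simp add: no_pole_at_def ratfun_eval_def flip: Fract_conv_to_fract)

text \<open>The reduced denominator divides every other denominator, so regularity and value can be
  read off from any fraction whose denominator does not vanish at \<open>z\<close>. The arithmetic
  that follows then needs no lowest terms.\<close>

lemma no_pole_at_fraction:
  assumes q: "poly q z \<noteq> 0"
  shows "no_pole_at z (to_fract p / to_fract q)"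
    and "ratfun_eval z (to_fract p / to_fract q) = poly p z / poly q z"
proof -
  let ?f = "to_fract p / to_fract q"
  define a b where "a = fst (quot_of_fract ?f)" and "b = snd (quot_of_fract ?f)"
  have b0: "b \<noteq> 0" and q0: "q \<noteq> 0"
    using q by (auto simp: b_def)
  have "to_fract a / to_fract b = ?f"
    by (metis Fract_conv_to_fract Fract_quot_of_fract a_def b_def)
  then have "to_fract (a * q) = to_fract (p * b)"
    using b0 q0 by (simp add: field_simps)
  then have eq: "a * q = p * b"
    by (simp only: to_fract_eq_iff)
  have "coprime a b"
    unfolding a_def b_def by (rule coprime_quot_of_fract)
  then have "b dvd q"
    using eq by (metis coprime_commute coprime_dvd_mult_right_iff dvd_triv_right)
  then have bz: "poly b z \<noteq> 0"
    using q by (auto elim: dvdE)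
  then show "no_pole_at z ?f"
    by (simp add: no_pole_at_def b_def)
  have "poly a z * poly q z = poly p z * poly b z"
    using eq by (metis poly_mult)
  then show "ratfun_eval z ?f = poly p z / poly q z"
    using bz q by (simp add: ratfun_eval_def a_def b_def field_simps)
qed

lemma no_pole_at_to_fract [simp]: "no_pole_at z (to_fract p)"
  and ratfun_eval_to_fract [simp]: "ratfun_eval z (to_fract p) = poly p z"
  by (simp_all add: no_pole_at_def ratfun_eval_def)

lemma no_pole_at_0 [simp]: "no_pole_at z 0" and ratfun_eval_0 [simp]: "ratfun_eval z 0 = 0"
  and no_pole_at_1 [simp]: "no_pole_at z 1" and ratfun_eval_1 [simp]: "ratfun_eval z 1 = 1"
  by (simp_all add: no_pole_at_def ratfun_eval_def)

lemma no_pole_at_add: "no_pole_at z f \<Longrightarrow> no_pole_at z g \<Longrightarrow> no_pole_at z (f + g)"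
  and ratfun_eval_add:
    "no_pole_at z f \<Longrightarrow> no_pole_at z g \<Longrightarrow> ratfun_eval z (f + g) = ratfun_eval z f + ratfun_eval z g"
proof -
  assume f: "no_pole_at z f" and g: "no_pole_at z g"
  obtain p q where f: "poly q z \<noteq> 0" "f = to_fract p / to_fract q" "ratfun_eval z f = poly p z / poly q z"
    using f by (rule no_pole_atE)
  obtain p' q' where g: "poly q' z \<noteq> 0" "g = to_fract p' / to_fract q'" "ratfun_eval z g = poly p' z / poly q' z"
    using g by (rule no_pole_atE)
  note h = f g
  have nz: "q \<noteq> 0" "q' \<noteq> 0" "poly (q * q') z \<noteq> 0"
    using h(1,4) by auto
  have eq: "f + g = to_fract (p * q' + p' * q) / to_fract (q * q')"
    using nz(1,2) by (simp add: h(2,5) add_frac_eq)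
  show "no_pole_at z (f + g)"
    unfolding eq by (rule no_pole_at_fraction(1)) (rule nz(3))
  show "ratfun_eval z (f + g) = ratfun_eval z f + ratfun_eval z g"
    unfolding eq no_pole_at_fraction(2)[OF nz(3)] using h(1,4) by (simp add: h(3,6) add_frac_eq)
qed

lemma no_pole_at_mult: "no_pole_at z f \<Longrightarrow> no_pole_at z g \<Longrightarrow> no_pole_at z (f * g)"
  and ratfun_eval_mult:
    "no_pole_at z f \<Longrightarrow> no_pole_at z g \<Longrightarrow> ratfun_eval z (f * g) = ratfun_eval z f * ratfun_eval z g"
proof -
  assume f: "no_pole_at z f" and g: "no_pole_at z g"
  obtain p q where f: "poly q z \<noteq> 0" "f = to_fract p / to_fract q" "ratfun_eval z f = poly p z / poly q z"
    using f by (rule no_pole_atE)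
  obtain p' q' where g: "poly q' z \<noteq> 0" "g = to_fract p' / to_fract q'" "ratfun_eval z g = poly p' z / poly q' z"
    using g by (rule no_pole_atE)
  note h = f g
  have nz: "q \<noteq> 0" "q' \<noteq> 0" "poly (q * q') z \<noteq> 0"
    using h(1,4) by auto
  have eq: "f * g = to_fract (p * p') / to_fract (q * q')"
    by (simp add: h(2,5))
  show "no_pole_at z (f * g)"
    unfolding eq by (rule no_pole_at_fraction(1)) (rule nz(3))
  show "ratfun_eval z (f * g) = ratfun_eval z f * ratfun_eval z g"
    unfolding eq no_pole_at_fraction(2)[OF nz(3)] by (simp add: h(3,6))
qed

lemma no_pole_at_sum:
  "(\<And>i. i \<in> I \<Longrightarrow> no_pole_at z (f i)) \<Longrightarrow> no_pole_at z (sum f I)"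
  by (induction I rule: infinite_finite_induct) (auto intro: no_pole_at_add)

lemma ratfun_eval_sum:
  "(\<And>i. i \<in> I \<Longrightarrow> no_pole_at z (f i)) \<Longrightarrow> ratfun_eval z (sum f I) = (\<Sum>i\<in>I. ratfun_eval z (f i))"
  by (induction I rule: infinite_finite_induct) (auto simp: ratfun_eval_add no_pole_at_sum)

lemma no_pole_at_prod:
  "(\<And>i. i \<in> I \<Longrightarrow> no_pole_at z (f i)) \<Longrightarrow> no_pole_at z (prod f I)"
  by (induction I rule: infinite_finite_induct) (auto intro: no_pole_at_mult)

lemma ratfun_eval_prod:
  "(\<And>i. i \<in> I \<Longrightarrow> no_pole_at z (f i)) \<Longrightarrow> ratfun_eval z (prod f I) = (\<Prod>i\<in>I. ratfun_eval z (f i))"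
  by (induction I rule: infinite_finite_induct) (auto simp: ratfun_eval_mult no_pole_at_prod)

lemma shifted_var_nonzero [simp]: "shifted_var z \<noteq> 0"
  by (simp add: shifted_var_def)

lemma no_pole_at_shifted_var [simp]: "no_pole_at z (shifted_var z)"
  and ratfun_eval_shifted_var [simp]: "ratfun_eval z (shifted_var z) = 0"
  by (simp_all add: shifted_var_def)

lemma shifted_var_power: "shifted_var z ^ k = to_fract ([:- z, 1:] ^ k)"
  by (induction k) (simp_all only: power_0 power_Suc to_fract_1 to_fract_mult shifted_var_def)

lemma no_pole_at_shifted_var_power [simp]: "no_pole_at z (shifted_var z ^ k)"
  and ratfun_eval_shifted_var_power [simp]: "ratfun_eval z (shifted_var z ^ k) = 0 ^ k"
  by (simp_all add: shifted_var_power)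

text \<open>Serves twice: the search stays pole-free when its vanishing columns are divided, and
  bounds on pole orders can be lowered one at a time.\<close>

lemma no_pole_at_divide_shifted_var:
  assumes "no_pole_at z f" "ratfun_eval z f = 0"
  shows "no_pole_at z (f / shifted_var z)"
proof -
  obtain p q where h: "poly q z \<noteq> 0" "f = to_fract p / to_fract q" "ratfun_eval z f = poly p z / poly q z"
    using assms(1) by (rule no_pole_atE)
  then have "poly p z = 0"
    using assms(2) by simp
  then obtain p' where "p = [:- z, 1:] * p'"
    unfolding poly_eq_0_iff_dvd by (elim dvdE)
  then have "f / shifted_var z = to_fract p' / to_fract q"
    using shifted_var_nonzero[of z] by (simp add: h(2) shifted_var_def[symmetric] del: mult_pCons_left shifted_var_nonzero)
  then show ?thesis
    using no_pole_at_fraction(1)[OF h(1)] by simp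
qed

lemma no_pole_at_power_mult:
  assumes "pole_order z f \<le> k"
  shows "no_pole_at z (shifted_var z ^ k * f)"
proof -
  define a b where "a = fst (quot_of_fract f)" and "b = snd (quot_of_fract f)"
  have f: "f = to_fract a / to_fract b" and "b \<noteq> 0"
    unfolding a_def b_def by (metis Fract_conv_to_fract Fract_quot_of_fract, simp)
  define t where "t = Polynomial.order z b"
  obtain c where c: "b = [:- z, 1:] ^ t * c" "\<not> [:- z, 1:] dvd c"
    using order_decomp[OF \<open>b \<noteq> 0\<close>] t_def by blast
  have tk: "k = t + (k - t)"
    using assms unfolding t_def b_def pole_order_def by simp
  have "shifted_var z ^ k * f = shifted_var z ^ (k - t) * (to_fract a / to_fract c)"
    by (subst tk) (simp add: f c(1) power_add shifted_var_power[symmetric])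
  moreover have "poly c z \<noteq> 0"
    using c(2) by (simp add: poly_eq_0_iff_dvd)
  ultimately show ?thesis
    by (metis no_pole_at_fraction(1) no_pole_at_mult no_pole_at_shifted_var_power)
qed

text \<open>A negative power times the opposite positive power is 1, but a pole-free factor times a
  function vanishing at \<open>z\<close> evaluates to 0.\<close>

lemma no_pole_at_powi_shifted_var:
  assumes "no_pole_at z (shifted_var z powi k)"
  shows "0 \<le> k"
proof (rule ccontr)
  assume "\<not> 0 \<le> k"
  then have k: "shifted_var z powi k * shifted_var z ^ nat (- k) = 1"
    by (simp add: power_int_def flip: power_mult_distrib)
  have "ratfun_eval z (shifted_var z powi k * shifted_var z ^ nat (- k)) = 0"
    using \<open>\<not> 0 \<le> k\<close> by (subst ratfun_eval_mult) (use assms in auto)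
  then show False
    using k by simp
qed

subsection \<open>Matrices without a pole\<close>

lemma no_pole_mat_iff:
  "no_pole_mat z A \<longleftrightarrow> (\<forall>i<dim_row A. \<forall>j<dim_col A. no_pole_at z (A $$ (i, j)))"
  unfolding no_pole_mat_def elements_mat_def by auto

lemma no_pole_matD:
  "no_pole_mat z A \<Longrightarrow> A \<in> carrier_mat m n \<Longrightarrow> i < m \<Longrightarrow> j < n \<Longrightarrow> no_pole_at z (A $$ (i, j))"
  by (auto simp: no_pole_mat_iff)

lemma no_pole_matI:
  "A \<in> carrier_mat m n \<Longrightarrow> (\<And>i j. i < m \<Longrightarrow> j < n \<Longrightarrow> no_pole_at z (A $$ (i, j))) \<Longrightarrow> no_pole_mat z A"
  by (auto simp: no_pole_mat_iff)

lemma eval_mat_dim [simp]: "dim_row (eval_mat z A) = dim_row A" "dim_col (eval_mat z A) = dim_col A"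
  by (simp_all add: eval_mat_def)

lemma eval_mat_carrier [simp]: "A \<in> carrier_mat m n \<Longrightarrow> eval_mat z A \<in> carrier_mat m n"
  by (simp add: eval_mat_def)

lemma eval_mat_index [simp]:
  "i < dim_row A \<Longrightarrow> j < dim_col A \<Longrightarrow> eval_mat z A $$ (i, j) = ratfun_eval z (A $$ (i, j))"
  by (simp add: eval_mat_def)

lemma mat_mult_index:
  "A \<in> carrier_mat m n \<Longrightarrow> B \<in> carrier_mat n p \<Longrightarrow> i < m \<Longrightarrow> j < p \<Longrightarrow>
    (A * B) $$ (i, j) = (\<Sum>k<n. A $$ (i, k) * B $$ (k, j))"
  by (auto simp: scalar_prod_def atLeast0LessThan intro!: sum.cong)

lemma mat_mult_vec_index:
  "A \<in> carrier_mat m n \<Longrightarrow> v \<in> carrier_vec n \<Longrightarrow> i < m \<Longrightarrow>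
    (A *\<^sub>v v) $ i = (\<Sum>k<n. A $$ (i, k) * v $ k)"
  by (auto simp: scalar_prod_def atLeast0LessThan intro!: sum.cong)

lemma no_pole_mat_mult:
  assumes "A \<in> carrier_mat m n" "B \<in> carrier_mat n p" "no_pole_mat z A" "no_pole_mat z B"
  shows "no_pole_mat z (A * B)"
  using assms unfolding no_pole_mat_iff
  by (auto simp: mat_mult_index[OF assms(1,2)] simp del: index_mult_mat(1)
      intro!: no_pole_at_sum no_pole_at_mult)

lemma eval_mat_mult:
  assumes "A \<in> carrier_mat m n" "B \<in> carrier_mat n p" "no_pole_mat z A" "no_pole_mat z B"
  shows "eval_mat z (A * B) = eval_mat z A * eval_mat z B"
proof (rule eq_matI)
  fix i j assume "i < dim_row (eval_mat z A * eval_mat z B)" "j < dim_col (eval_mat z A * eval_mat z B)"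
  then have ij: "i < m" "j < p"
    using assms by auto
  have "ratfun_eval z ((A * B) $$ (i, j)) = (\<Sum>k<n. ratfun_eval z (A $$ (i, k) * B $$ (k, j)))"
    unfolding mat_mult_index[OF assms(1,2) ij] 
    by (rule ratfun_eval_sum) (use assms ij in \<open>auto simp: no_pole_mat_iff intro!: no_pole_at_mult\<close>)
  also have "\<dots> = (\<Sum>k<n. ratfun_eval z (A $$ (i, k)) * ratfun_eval z (B $$ (k, j)))"
    by (rule sum.cong) (use assms ij in \<open>auto simp: no_pole_mat_iff intro!: ratfun_eval_mult\<close>)
  also have "\<dots> = (eval_mat z A * eval_mat z B) $$ (i, j)"
    using assms ij by (subst mat_mult_index[of _ m n _ p]) auto
  finally show "eval_mat z (A * B) $$ (i, j) = (eval_mat z A * eval_mat z B) $$ (i, j)"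
    using ij assms by (subst eval_mat_index) auto
qed (use assms in auto)

lemma const_mat_dim [simp]: "dim_row (const_mat A) = dim_row A" "dim_col (const_mat A) = dim_col A"
  by (simp_all add: const_mat_def)

lemma const_mat_carrier [simp]: "A \<in> carrier_mat m n \<Longrightarrow> const_mat A \<in> carrier_mat m n"
  by (simp add: const_mat_def)

lemma no_pole_const_mat [simp]: "no_pole_mat z (const_mat A)"
  by (simp add: no_pole_mat_iff const_mat_def)

lemma eval_const_mat [simp]: "eval_mat z (const_mat A) = A"
  by (rule eq_matI) (auto simp: eval_mat_def const_mat_def)

text \<open>Evaluation respects sums and products only of pole-free functions and is no homomorphism
  on the field, so the permutation expansion is evaluated term by term, with the signs recognised as
  constant polynomials.\<close>

lemma det_eval_mat:
  assumes "A \<in> carrier_mat n n" "no_pole_mat z A"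
  shows "det (eval_mat z A) = ratfun_eval z (det A)"
proof -
  have "[:- 1:] = (- 1 :: complex poly)"
    by (simp add: one_pCons)
  then have neg: "(- 1 :: ratfun) = to_fract [:- 1:]"
    by (simp only: to_fract_uminus to_fract_1)
  have sgn: "(signof p :: ratfun) = to_fract [:signof p:]" for p :: "nat \<Rightarrow> nat"
  proof (cases "evenperm p")
    case True
    then show ?thesis
      by (simp add: sign_def flip: one_pCons)
  next
    case False
    then show ?thesis
      using neg by (simp add: sign_def)
  qed
  have np: "no_pole_at z (\<Prod>i = 0..<n. A $$ (i, p i))" if "p permutes {0..<n}" for p
    by (rule no_pole_at_prod) (use assms permutes_in_image[OF that] in \<open>auto simp: no_pole_mat_iff\<close>)
  have "ratfun_eval z (det A) = (\<Sum>p\<in>{p. p permutes {0..<n}}. ratfun_eval z (signof p * (\<Prod>i = 0..<n. A $$ (i, p i))))"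
    unfolding det_def'[OF assms(1)]
    by (rule ratfun_eval_sum) (auto simp: sgn intro!: no_pole_at_mult np)
  also have "\<dots> = (\<Sum>p\<in>{p. p permutes {0..<n}}. signof p * (\<Prod>i = 0..<n. eval_mat z A $$ (i, p i)))"
  proof (rule sum.cong[OF refl], clarify)
    fix p assume p: "p permutes {0..<n}"
    have "ratfun_eval z (signof p * (\<Prod>i = 0..<n. A $$ (i, p i)))
        = signof p * ratfun_eval z (\<Prod>i = 0..<n. A $$ (i, p i))"
      by (subst ratfun_eval_mult) (auto simp: sgn np[OF p])
    also have "ratfun_eval z (\<Prod>i = 0..<n. A $$ (i, p i)) = (\<Prod>i = 0..<n. ratfun_eval z (A $$ (i, p i)))"
      by (rule ratfun_eval_prod) (use assms permutes_in_image[OF p] in \<open>auto simp: no_pole_mat_iff\<close>)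
    also have "\<dots> = (\<Prod>i = 0..<n. eval_mat z A $$ (i, p i))"
      by (rule prod.cong) (use assms permutes_in_image[OF p] in auto)
    finally show "ratfun_eval z (signof p * (\<Prod>i = 0..<n. A $$ (i, p i)))
       = signof p * (\<Prod>i = 0..<n. eval_mat z A $$ (i, p i))" .
  qed
  also have "\<dots> = det (eval_mat z A)"
    by (rule det_def'[symmetric]) (use assms in auto)
  finally show ?thesis ..
qed

subsection \<open>Injective matrices\<close>

text \<open>Independence of the columns as a family. The kernel form avoids
  \<open>set (cols A)\<close>, which forgets repetitions, and it covers the matrix without columns
  with which the search starts.\<close>

definition inj_mat :: "'a :: field mat \<Rightarrow> bool" where
  "inj_mat A \<longleftrightarrow> (\<forall>v \<in> carrier_vec (dim_col A). A *\<^sub>v v = 0\<^sub>v (dim_row A) \<longrightarrow> v = 0\<^sub>v (dim_col A))"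

lemma inj_matI:
  assumes "A \<in> carrier_mat m n"
    and "\<And>v. v \<in> carrier_vec n \<Longrightarrow> A *\<^sub>v v = 0\<^sub>v m \<Longrightarrow> v = 0\<^sub>v n"
  shows "inj_mat A"
  using assms by (auto simp: inj_mat_def)

lemma inj_matD:
  assumes "inj_mat A" "A \<in> carrier_mat m n" "v \<in> carrier_vec n" "A *\<^sub>v v = 0\<^sub>v m"
  shows "v = 0\<^sub>v n"
  using assms by (auto simp: inj_mat_def)

lemma inj_mat_distinct_cols:
  assumes A: "A \<in> carrier_mat m n" and inj: "inj_mat A"
  shows "distinct (cols A)"
  unfolding distinct_conv_nth
proof (intro allI impI)
  fix i j assume ij: "i < length (cols A)" "j < length (cols A)" "i \<noteq> j"
  then have ij': "i < n" "j < n"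
    using A by auto
  show "cols A ! i \<noteq> cols A ! j"
  proof
    assume eq: "cols A ! i = cols A ! j"
    have "A *\<^sub>v (unit_vec n i - unit_vec n j) = col A i - col A j"
      using A ij' by (intro eq_vecI) (auto simp: mult_minus_distrib_mat_vec)
    also have "\<dots> = 0\<^sub>v m"
      using eq ij' A by auto
    finally have "unit_vec n i - unit_vec n j = (0\<^sub>v n :: 'a vec)"
      by (intro inj_matD[OF inj A]) auto
    then have "(unit_vec n i - unit_vec n j :: 'a vec) $ i = 0\<^sub>v n $ i"
      by simp
    then show False
      using ij ij' by simp
  qed
qed

lemma mat_rank_eq_dim_col_iff:
  assumes A: "A \<in> carrier_mat m n"
  shows "mat_rank A = n \<longleftrightarrow> inj_mat A"
proof -
  interpret vec_space "TYPE('a)" m .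
  have rank: "mat_rank A = rank A"
    using A by (simp add: mat_rank_def)
  show ?thesis
  proof
    assume "mat_rank A = n"
    then have r: "rank A = n"
      by (simp add: rank)
    \<comment> \<open>A maximal independent set of columns has \<open>n\<close> elements, so no
      column is repeated; this licenses the passage from the set of columns to the kernel.\<close>
    obtain S where S: "maximal S (\<lambda>T. T \<subseteq> set (cols A) \<and> lin_indpt T)"
      using maximal_exists_superset[of "set (cols A)" "\<lambda>T. T \<subseteq> set (cols A) \<and> lin_indpt T" "{}"]
      by (auto simp: lin_dep_def)
    have "n \<le> card (set (cols A))"
      using rank_card_indpt[OF A S] r S card_mono[of "set (cols A)" S] by (auto simp: maximal_def)
    then have dist: "distinct (cols A)"
      using A by (intro card_distinct antisym[OF card_length]) simp
    have "lin_indpt (set (cols A))"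
      by (rule full_rank_lin_indpt[OF A r dist])
    then show "inj_mat A"
      using lin_depI[OF A _ _ _ dist] by (intro inj_matI[OF A]) blast
  next
    assume inj: "inj_mat A"
    have dist: "distinct (cols A)"
      by (rule inj_mat_distinct_cols[OF A inj])
    have "lin_indpt (set (cols A))"
    proof
      assume "lin_dep (set (cols A))"
      then obtain v where "v \<in> carrier_vec n" "v \<noteq> 0\<^sub>v n" "A *\<^sub>v v = 0\<^sub>v m"
        using lin_depE[OF A _ dist] by auto
      then show False
        using inj_matD[OF inj A] by simp
    qed
    then show "mat_rank A = n"
      using lin_indpt_full_rank[OF A dist] by (simp add: rank)
  qed
qed

lemma inj_mat_iff_det:
  assumes "A \<in> carrier_mat n n"
  shows "inj_mat A \<longleftrightarrow> det A \<noteq> 0"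
  using det_0_iff_vec_prod_zero_field[OF assms] assms by (auto simp: inj_mat_def)

lemma inj_mat_mult:
  assumes A: "A \<in> carrier_mat m n" "inj_mat A" and B: "B \<in> carrier_mat n p" "inj_mat B"
  shows "inj_mat (A * B)"
proof (rule inj_matI)
  fix v :: "'a vec" assume v: "v \<in> carrier_vec p" "A * B *\<^sub>v v = 0\<^sub>v m"
  then have "A *\<^sub>v (B *\<^sub>v v) = 0\<^sub>v m"
    using A(1) B(1) by (simp add: assoc_mult_mat_vec)
  then have "B *\<^sub>v v = 0\<^sub>v n"
    using A B(1) v(1) by (intro inj_matD[OF A(2,1)]) auto
  then show "v = 0\<^sub>v p"
    using B v(1) by (intro inj_matD[OF B(2,1)]) auto
qed (use A B in auto)

text \<open>A wide matrix padded with zero rows becomes square and singular, and a kernel vector of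
  the padded matrix also kills \<open>A\<close>.\<close>

lemma inj_mat_dim_le:
  assumes A: "A \<in> carrier_mat m n" and inj: "inj_mat A"
  shows "n \<le> m"
proof (rule ccontr)
  assume "\<not> n \<le> m"
  then have mn: "m < n"
    by simp
  define B where "B = mat n n (\<lambda>(i, j). if i < m then A $$ (i, j) else 0)"
  have B: "B \<in> carrier_mat n n"
    by (simp add: B_def)
  have "B $$ (n - 1, j) = 0" if "j < n" for j
    using that mn by (auto simp: B_def)
  then have "det B = 0"
    using mn by (subst laplace_expansion_row[OF B, of "n - 1"]) auto
  then obtain v where v: "v \<in> carrier_vec n" "v \<noteq> 0\<^sub>v n" "B *\<^sub>v v = 0\<^sub>v n"
    using det_0_iff_vec_prod_zero_field[OF B] by auto
  have "A *\<^sub>v v = 0\<^sub>v m"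
  proof (rule eq_vecI)
    fix i assume "i < dim_vec (0\<^sub>v m :: 'a vec)"
    then have i: "i < m"
      by simp
    have "row A i = row B i"
      using i mn A by (auto simp: B_def)
    moreover have "(B *\<^sub>v v) $ i = 0"
      using v(3) i mn by simp
    ultimately show "(A *\<^sub>v v) $ i = 0\<^sub>v m $ i"
      using i mn A B by simp
  qed (use A in auto)
  then show False
    using inj_matD[OF inj A v(1)] v(2) by simp
qed

lemma invertible_of_det_nonzero:
  fixes A :: "'a :: field mat"
  assumes "A \<in> carrier_mat n n" "det A \<noteq> 0"
  obtains B where "B \<in> carrier_mat n n" "A * B = 1\<^sub>m n" "B * A = 1\<^sub>m n"
  using det_non_zero_imp_unit[OF assms, of "()"] by (auto simp: Units_def ring_mat_def)

lemma invertible_mat_det_nonzero: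
  fixes A :: "'a :: field mat"
  assumes A: "A \<in> carrier_mat n n" and inv: "invertible_mat A"
  shows "det A \<noteq> 0"
proof -
  obtain B where B: "A * B = 1\<^sub>m n" "B * A = 1\<^sub>m (dim_row B)"
    using inv A by (auto simp: invertible_mat_def inverts_mat_def)
  then have "B \<in> carrier_mat n n"
    using A by (metis carrier_matD carrier_matI index_mult_mat(2,3) index_one_mat(2,3))
  then have "det A * det B = 1"
    using det_mult[OF A, of B] B(1) by simp
  then show ?thesis
    by auto
qed

subsection \<open>The Moore--Penrose inverse\<close>

lemma mat_adjoint_dim [simp]:
  "dim_row (mat_adjoint A) = dim_col A" "dim_col (mat_adjoint A) = dim_row A"
  by (simp_all add: mat_adjoint_def)

lemma mat_adjoint_carrier [simp]: "A \<in> carrier_mat m n \<Longrightarrow> mat_adjoint A \<in> carrier_mat n m"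
  by auto

lemma mat_adjoint_index [simp]:
  "i < dim_col A \<Longrightarrow> j < dim_row A \<Longrightarrow> mat_adjoint A $$ (i, j) = conjugate (A $$ (j, i))"
  by (simp add: mat_adjoint_def mat_of_rows_index)

lemma mat_adjoint_adjoint [simp]: "mat_adjoint (mat_adjoint A) = A"
  by (rule eq_matI) auto

lemma mat_adjoint_mult:
  assumes "A \<in> carrier_mat m n" "B \<in> carrier_mat n p"
  shows "mat_adjoint (A * B) = mat_adjoint B * mat_adjoint A"
  using assms
  by (intro eq_matI) (auto simp: scalar_prod_def sum_conjugate conjugate_dist_mul mult.commute intro!: sum.cong)

lemma mat_adjoint_one [simp]: "mat_adjoint (1\<^sub>m n) = (1\<^sub>m n :: complex mat)"
  by (rule eq_matI) auto

text \<open>Self-adjointness lets the factors of \<open>A * X = (A * Y) * (A * X)\<close> be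
  swapped, which leaves \<open>A * Y\<close>; likewise \<open>X * A = Y * A\<close>, and then
  \<open>X = X A X = Y A Y = Y\<close>. The definition by \<open>THE\<close> rests on this.\<close>

lemma is_moore_penrose_unique:
  assumes X: "is_moore_penrose A X" and Y: "is_moore_penrose A Y"
  shows "X = Y"
proof -
  let ?m = "dim_row A" and ?n = "dim_col A"
  have A: "A \<in> carrier_mat ?m ?n"
    by simp
  note XD = X[unfolded is_moore_penrose_def] and YD = Y[unfolded is_moore_penrose_def]
  have c: "X \<in> carrier_mat ?n ?m" "Y \<in> carrier_mat ?n ?m"
    using XD YD by auto
  have AXA: "A * X * A = A" "A * Y * A = A"
    using XD YD by auto
  have AXY: "A * X = (A * Y) * (A * X)"
    by (metis AXA(2) assoc_mult_mat[OF mult_carrier_mat[OF A c(2)] A c(1)])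
  have "A * X = mat_adjoint (A * X)"
    using XD by simp
  also have "\<dots> = mat_adjoint ((A * Y) * (A * X))"
    using AXY by simp
  also have "\<dots> = mat_adjoint (A * X) * mat_adjoint (A * Y)"
    using A c by (intro mat_adjoint_mult) auto
  also have "\<dots> = (A * X) * (A * Y)"
    using XD YD by simp
  also have "\<dots> = A * Y"
    by (metis AXA(1) assoc_mult_mat[OF mult_carrier_mat[OF A c(1)] A c(2)])
  finally have AX: "A * X = A * Y" .
  have XAY: "X * A = (X * A) * (Y * A)"
    by (metis AXA(2) assoc_mult_mat[OF c(1) A mult_carrier_mat[OF c(2) A]] assoc_mult_mat[OF A c(2) A])
  have "X * A = mat_adjoint (X * A)"
    using XD by simp
  also have "\<dots> = mat_adjoint ((X * A) * (Y * A))"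
    using XAY by simp
  also have "\<dots> = mat_adjoint (Y * A) * mat_adjoint (X * A)"
    using A c by (intro mat_adjoint_mult) auto
  also have "\<dots> = (Y * A) * (X * A)"
    using XD YD by simp
  also have "\<dots> = Y * A"
    by (metis AXA(1) assoc_mult_mat[OF c(2) A mult_carrier_mat[OF c(1) A]] assoc_mult_mat[OF A c(1) A])
  finally have XA: "X * A = Y * A" .
  have "X = Y * A * X"
    using XD XA by metis
  also have "\<dots> = Y * A * Y"
    by (simp only: AX assoc_mult_mat[OF c(2) A c(1)] assoc_mult_mat[OF c(2) A c(2)])
  also have "\<dots> = Y"
    using YD by simp
  finally show ?thesis .
qed

text \<open>With independent columns the Gram matrix \<open>G = ?H * A\<close> is invertible,
  because \<open>G v = 0\<close> makes the norm of \<open>A v\<close> vanish; its inverse times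
  \<open>?H\<close> is the classical formula. The matrices \<open>L0\<close> of the search are
  always of this kind.\<close>

lemma is_moore_penrose_inj_mat:
  assumes A: "A \<in> carrier_mat m n" and inj: "inj_mat A"
  obtains X where "is_moore_penrose A X"
proof -
  let ?H = "mat_adjoint A"
  define G where "G = ?H * A"
  have H: "?H \<in> carrier_mat n m" and G: "G \<in> carrier_mat n n"
    using A by (auto simp: G_def)
  have "inj_mat G"
  proof (rule inj_matI[OF G])
    fix v :: "complex vec" assume v: "v \<in> carrier_vec n" "G *\<^sub>v v = 0\<^sub>v n"
    let ?w = "A *\<^sub>v v"
    have w: "?w \<in> carrier_vec m"
      using A v by auto
    have Hw: "?H *\<^sub>v ?w = 0\<^sub>v n"
      using v A H by (simp add: G_def assoc_mult_mat_vec[OF H A])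
    have adj: "(A *\<^sub>v v) \<bullet> conjugate u = v \<bullet> conjugate (?H *\<^sub>v u)" if "u \<in> carrier_vec m" for u
    proof -
      have "(A *\<^sub>v v) \<bullet> conjugate u = (\<Sum>i<m. \<Sum>j<n. A $$ (i, j) * v $ j * conjugate (u $ i))"
        using A v that by (auto simp: scalar_prod_def atLeast0LessThan sum_distrib_right intro!: sum.cong)
      also have "\<dots> = (\<Sum>j<n. \<Sum>i<m. v $ j * (A $$ (i, j) * conjugate (u $ i)))"
        by (subst sum.swap) (simp add: mult_ac)
      also have "\<dots> = v \<bullet> conjugate (?H *\<^sub>v u)"
        using A v that
        by (auto simp: scalar_prod_def atLeast0LessThan sum_distrib_left sum_conjugate conjugate_dist_mul
            intro!: sum.cong)
      finally show ?thesis .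
    qed
    have "?w \<bullet> conjugate ?w = 0"
      using adj[OF w] v(1) by (simp add: Hw)
    then have "?w = 0\<^sub>v m"
      using w conjugate_square_eq_0_vec by blast
    then show "v = 0\<^sub>v n"
      by (rule inj_matD[OF inj A v(1)])
  qed
  then have "det G \<noteq> 0"
    using inj_mat_iff_det[OF G] by simp
  then obtain K where K: "K \<in> carrier_mat n n" "G * K = 1\<^sub>m n" "K * G = 1\<^sub>m n"
    by (rule invertible_of_det_nonzero[OF G])
  have "mat_adjoint G = G"
    using mat_adjoint_mult[OF H A] by (simp add: G_def)
  then have "mat_adjoint K * G = 1\<^sub>m n"
    using mat_adjoint_mult[OF G K(1)] K(2) by simp
  then have "mat_adjoint K = K"
    using assoc_mult_mat[of "mat_adjoint K" n n G n K n] K(1,2) G by simp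
  then have AKH: "mat_adjoint (A * (K * ?H)) = A * (K * ?H)"
    using A H K(1) by (simp add: mat_adjoint_mult[of _ m n _ m] mat_adjoint_mult[of _ n n _ m] assoc_mult_mat[of _ m n _ n _ m])
  have KHA: "(K * ?H) * A = 1\<^sub>m n"
    using A H K by (simp add: assoc_mult_mat[of _ n n _ m _ n] G_def)
  have "is_moore_penrose A (K * ?H)"
    unfolding is_moore_penrose_def
  proof (intro conjI)
    show "A * (K * ?H) * A = A"
      using A H K(1) KHA by (simp add: assoc_mult_mat[of _ m n _ m _ n])
    show "K * ?H * A * (K * ?H) = K * ?H"
      unfolding KHA using A H K(1) by (simp add: left_mult_one_mat[of _ n m])
  qed (use A K(1) H AKH KHA in auto)
  then show thesis
    by (rule that)
qed

lemma is_moore_penrose_moore_penrose: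
  assumes "A \<in> carrier_mat m n" "inj_mat A"
  shows "is_moore_penrose A (moore_penrose A)"
proof -
  obtain X where X: "is_moore_penrose A X"
    using is_moore_penrose_inj_mat[OF assms] .
  show ?thesis
    unfolding moore_penrose_def
    using theI[of "is_moore_penrose A", OF X is_moore_penrose_unique[OF _ X]] .
qed

subsection \<open>One step of the search\<close>

lemma append_cols_carrier [simp]:
  "A \<in> carrier_mat m a \<Longrightarrow> B \<in> carrier_mat m b \<Longrightarrow> A @\<^sub>c B \<in> carrier_mat m (a + b)"
  by (auto simp: append_cols_def)

lemma append_cols_index:
  "A \<in> carrier_mat m a \<Longrightarrow> B \<in> carrier_mat m b \<Longrightarrow> i < m \<Longrightarrow> j < a + b \<Longrightarrow>
    (A @\<^sub>c B) $$ (i, j) = (if j < a then A $$ (i, j) else B $$ (i, j - a))"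
  by (auto simp: append_cols_def)

lemma append_cols_assoc:
  assumes "A \<in> carrier_mat m a" "B \<in> carrier_mat m b" "C \<in> carrier_mat m c"
  shows "(A @\<^sub>c B) @\<^sub>c C = A @\<^sub>c (B @\<^sub>c C)"
proof -
  have "A @\<^sub>c B \<in> carrier_mat m (a + b)" "B @\<^sub>c C \<in> carrier_mat m (b + c)"
    using assms by auto
  then show ?thesis
    using assms by (intro eq_matI) (auto simp: append_cols_def)
qed

lemma append_cols_mult_vec:
  fixes A B :: "'a :: semiring_1 mat"
  assumes "A \<in> carrier_mat m a" "B \<in> carrier_mat m b" "u \<in> carrier_vec a" "v \<in> carrier_vec b"
  shows "(A @\<^sub>c B) *\<^sub>v (u @\<^sub>v v) = A *\<^sub>v u + B *\<^sub>v v"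
proof -
  have "(A @\<^sub>c B) *\<^sub>v (u @\<^sub>v v)
      = (A *\<^sub>v u + B *\<^sub>v v) @\<^sub>v (0\<^sub>m 0 a *\<^sub>v u + 0\<^sub>m 0 b *\<^sub>v v)"
    using four_block_mat_mult_vec[of A m a B b "0\<^sub>m 0 a" 0 "0\<^sub>m 0 b" u v] assms
    by (auto simp: append_cols_def)
  then show ?thesis
    using assms by (auto intro!: eq_vecI)
qed

lemma zero_mat_mult_vec: "v \<in> carrier_vec n \<Longrightarrow> 0\<^sub>m m n *\<^sub>v v = 0\<^sub>v m"
  for v :: "'a :: semiring_0 vec"
  by (intro eq_vecI) auto

lemma mat_mult_zero_vec: "A \<in> carrier_mat m n \<Longrightarrow> A *\<^sub>v 0\<^sub>v n = 0\<^sub>v m"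
  for A :: "'a :: semiring_0 mat"
  by (intro eq_vecI) auto

text \<open>All that is later needed of a step, with \<open>Q\<close> eliminated. Independence of
  the new columns from the old ones comes from the projection \<open>1 - L0 * X\<close>, which kills
  \<open>L0\<close> and fixes \<open>Lp\<close>.\<close>

lemma toeplitz_step_spec:
  assumes A: "A \<in> carrier_mat m n" and rho: "\<rho> \<le> n"
    and inj: "inj_mat (mat m \<rho> (($$) A))" and step: "toeplitz_step A \<rho> N L"
  shows "\<rho> \<le> dim_col L" "dim_col L \<le> n" "L \<in> carrier_mat m (dim_col L)" "inj_mat L"
    "N \<in> carrier_mat n n" "det N \<noteq> 0"
    "A * N = L @\<^sub>c 0\<^sub>m m (n - dim_col L)"
    "\<And>i j. i < n \<Longrightarrow> j < \<rho> \<Longrightarrow> N $$ (i, j) = (if i = j then 1 else 0)"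
proof -
  define \<nu> where "\<nu> = n - \<rho>"
  have n: "n = \<rho> + \<nu>"
    using rho by (simp add: \<nu>_def)
  obtain L0 R1 A3 A4 where sb: "split_block A m \<rho> = (L0, R1, A3, A4)"
    by (metis prod_cases4)
  have L0: "L0 \<in> carrier_mat m \<rho>" and R1: "R1 \<in> carrier_mat m \<nu>"
    and A3: "A3 \<in> carrier_mat 0 \<rho>" and A4: "A4 \<in> carrier_mat 0 \<nu>" and Ab: "A = four_block_mat L0 R1 A3 A4"
    using split_block[OF sb, of 0 \<nu>] A n by auto
  have injL0: "inj_mat L0"
    using inj sb A by (simp add: split_block_def Let_def)
  define X where "X = moore_penrose L0"
  have "is_moore_penrose L0 X"
    unfolding X_def by (rule is_moore_penrose_moore_penrose[OF L0 injL0])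
  then have X: "X \<in> carrier_mat \<rho> m" and LXL: "L0 * X * L0 = L0"
    using L0 by (auto simp: is_moore_penrose_def)
  define Z where "Z = - (X * R1)"
  have Z: "Z \<in> carrier_mat \<rho> \<nu>"
    using X R1 by (auto simp: Z_def)
  obtain Q k Lp where Q: "Q \<in> carrier_mat \<nu> \<nu>" and uni: "unitary_mat Q" and k: "k \<le> \<nu>"
    and Lp: "Lp \<in> carrier_mat m k" and rank: "mat_rank Lp = k"
    and W: "(1\<^sub>m m - L0 * X) * R1 * Q = Lp @\<^sub>c 0\<^sub>m m (\<nu> - k)"
    and N: "N = four_block_mat (1\<^sub>m \<rho>) (Z * Q) (0\<^sub>m \<nu> \<rho>) Q" and L: "L = L0 @\<^sub>c Lp"
    using step A rho unfolding toeplitz_step_def Let_def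
    by (auto simp: sb X_def Z_def \<nu>_def)
  \<comment> \<open>The projection whose kernel is the column span of \<open>L0\<close>; applied to
    a relation between columns of \<open>L\<close>, it leaves only the part in
    \<open>Lp\<close>.\<close>
  define P where "P = 1\<^sub>m m - L0 * X"
  have LX: "L0 * X \<in> carrier_mat m m" and P: "P \<in> carrier_mat m m"
    using L0 X by (auto simp: P_def)
  have LXLX: "(L0 * X) * (L0 * X) = L0 * X"
    using LXL assoc_mult_mat[OF LX L0 X] by simp
  have PL0: "P * L0 = 0\<^sub>m m \<rho>"
    unfolding P_def using minus_mult_distrib_mat[OF one_carrier_mat LX L0] L0 LXL by simp
  have "P * (L0 * X) = 0\<^sub>m m m"
    unfolding P_def
    using minus_mult_distrib_mat[OF one_carrier_mat LX LX] left_mult_one_mat[OF LX] LXLX LX by simp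
  moreover have "P * P = P * 1\<^sub>m m - P * (L0 * X)"
    by (subst (2) P_def) (rule mult_minus_distrib_mat[OF P one_carrier_mat LX])
  ultimately have PP: "P * P = P"
    using P right_mult_one_mat[OF P] by auto
  \<comment> \<open>\<open>E\<close> picks the first \<open>k\<close> columns. It exhibits
    \<open>Lp\<close> as \<open>P\<close> times a matrix, so that \<open>P * P = P\<close> gives
    \<open>P * Lp = Lp\<close>.\<close>
  define E where "E = Matrix.mat \<nu> k (\<lambda>(i, j). if i = j then 1 else 0 :: complex)"
  have E: "E \<in> carrier_mat \<nu> k"
    by (simp add: E_def)
  have z: "0\<^sub>m m (\<nu> - k) \<in> carrier_mat m (\<nu> - k)"
    by simp
  have R1Q: "R1 * Q \<in> carrier_mat m \<nu>"
    using R1 Q by auto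
  have W': "P * (R1 * Q) = Lp @\<^sub>c 0\<^sub>m m (\<nu> - k)"
    using W assoc_mult_mat[OF P R1 Q] by (simp add: P_def)
  have PRQ: "P * (R1 * Q) \<in> carrier_mat m \<nu>"
    using P R1Q by auto
  have LpE: "Lp = P * (R1 * Q) * E"
  proof (rule eq_matI)
    fix i j assume "i < dim_row (P * (R1 * Q) * E)" "j < dim_col (P * (R1 * Q) * E)"
    then have ij: "i < m" "j < k"
      using P E by auto
    have "(P * (R1 * Q) * E) $$ (i, j) = (\<Sum>l<\<nu>. (P * (R1 * Q)) $$ (i, l) * E $$ (l, j))"
      by (rule mat_mult_index[OF PRQ E ij])
    also have "\<dots> = (\<Sum>l<\<nu>. if l = j then (P * (R1 * Q)) $$ (i, l) else 0)"
      by (rule sum.cong) (use ij in \<open>auto simp: E_def\<close>)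
    also have "\<dots> = Lp $$ (i, j)"
      unfolding W' using ij k append_cols_index[OF Lp z, of i j] by simp
    finally show "Lp $$ (i, j) = (P * (R1 * Q) * E) $$ (i, j)" ..
  qed (use Lp P E in auto)
  have PLp: "P * Lp = Lp"
    unfolding LpE using PP by (simp only: assoc_mult_mat[OF P PRQ E, symmetric] assoc_mult_mat[OF P P R1Q, symmetric])
  have Lc: "L \<in> carrier_mat m (\<rho> + k)"
    unfolding L using L0 Lp by simp
  then have dL: "dim_col L = \<rho> + k"
    by simp
  show "\<rho> \<le> dim_col L" "dim_col L \<le> n" "L \<in> carrier_mat m (dim_col L)"
    using Lc k n by auto
  show "inj_mat L"
  proof (rule inj_matI[OF Lc])
    fix v :: "complex vec" assume v: "v \<in> carrier_vec (\<rho> + k)" "L *\<^sub>v v = 0\<^sub>v m"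
    define a b where "a = vec_first v \<rho>" and "b = vec_last v k"
    have a: "a \<in> carrier_vec \<rho>" and b: "b \<in> carrier_vec k" and vab: "v = a @\<^sub>v b"
      using v(1) by (auto simp: a_def b_def)
    have eq: "L0 *\<^sub>v a + Lp *\<^sub>v b = 0\<^sub>v m"
      using v(2) append_cols_mult_vec[OF L0 Lp a b] by (simp add: L vab)
    have "P *\<^sub>v (L0 *\<^sub>v a + Lp *\<^sub>v b) = P *\<^sub>v (L0 *\<^sub>v a) + P *\<^sub>v (Lp *\<^sub>v b)"
      using P L0 Lp a b by (intro mult_add_distrib_mat_vec) auto
    also have "P *\<^sub>v (L0 *\<^sub>v a) = 0\<^sub>v m"
      using assoc_mult_mat_vec[OF P L0 a] PL0 zero_mat_mult_vec[OF a] by simp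
    also have "P *\<^sub>v (Lp *\<^sub>v b) = Lp *\<^sub>v b"
      using assoc_mult_mat_vec[OF P Lp b] PLp by simp
    finally have "Lp *\<^sub>v b = 0\<^sub>v m"
      using eq mat_mult_zero_vec[OF P] mult_mat_vec_carrier[OF Lp b] by simp
    moreover have "inj_mat Lp"
      using mat_rank_eq_dim_col_iff[OF Lp] rank by simp
    ultimately have b0: "b = 0\<^sub>v k"
      using inj_matD[OF _ Lp b] by simp
    then have "L0 *\<^sub>v a = 0\<^sub>v m"
      using eq mat_mult_zero_vec[OF Lp] mult_mat_vec_carrier[OF L0 a] by simp
    then have "a = 0\<^sub>v \<rho>"
      using inj_matD[OF injL0 L0 a] by simp
    then show "v = 0\<^sub>v (\<rho> + k)"
      by (auto simp: vab b0)
  qed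
  show "N \<in> carrier_mat n n"
    unfolding N n using Q by (intro four_block_carrier_mat) auto
  have "mat_adjoint Q * Q = 1\<^sub>m \<nu>"
    using uni Q by (simp add: unitary_mat_def)
  then have "det (mat_adjoint Q) * det Q = 1"
    using det_mult[of "mat_adjoint Q" \<nu> Q] Q by simp
  moreover have "det N = det (1\<^sub>m \<rho>) * det Q"
    unfolding N using Z Q by (intro det_four_block_mat_lower_left_zero) auto
  ultimately show "det N \<noteq> 0"
    by auto
  show "N $$ (i, j) = (if i = j then 1 else 0)" if "i < n" "j < \<rho>" for i j
    using that Q unfolding N n by auto
  have ZQ: "Z * Q \<in> carrier_mat \<rho> \<nu>"
    using Z Q by auto
  have XR: "X * R1 \<in> carrier_mat \<rho> \<nu>" and XRQ: "X * (R1 * Q) \<in> carrier_mat \<rho> \<nu>"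
    using X R1 R1Q by auto
  \<comment> \<open>The right block of \<open>A * N\<close>: the correction by \<open>Z\<close>
    removes from \<open>R1 * Q\<close> its component in the span of \<open>L0\<close>.\<close>
  have "L0 * (Z * Q) + R1 * Q = P * (R1 * Q)"
  proof -
    have "Z * Q = - (X * (R1 * Q))"
      unfolding Z_def using uminus_mult_left_mat[of "X * R1" Q] X R1 Q assoc_mult_mat[OF X R1 Q] by auto
    then have "L0 * (Z * Q) = - (L0 * X * (R1 * Q))"
      using L0 X R1Q assoc_mult_mat[OF L0 X R1Q] uminus_mult_right_mat[of L0 "X * (R1 * Q)"] by auto
    moreover have "P * (R1 * Q) = R1 * Q - L0 * X * (R1 * Q)"
      unfolding P_def using minus_mult_distrib_mat[OF one_carrier_mat LX R1Q] left_mult_one_mat[OF R1Q] by simp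
    moreover have "L0 * X * (R1 * Q) \<in> carrier_mat m \<nu>"
      using LX R1Q by (rule mult_carrier_mat)
    moreover have "- B + C = C - B" if "B \<in> carrier_mat m \<nu>" "C \<in> carrier_mat m \<nu>" for B C :: "complex mat"
      using that by (intro eq_matI) auto
    ultimately show ?thesis
      using R1Q by simp
  qed
  moreover have "A * N = four_block_mat (L0 * 1\<^sub>m \<rho> + R1 * 0\<^sub>m \<nu> \<rho>) (L0 * (Z * Q) + R1 * Q)
      (A3 * 1\<^sub>m \<rho> + A4 * 0\<^sub>m \<nu> \<rho>) (A3 * (Z * Q) + A4 * Q)"
    unfolding N Ab by (rule mult_four_block_mat[OF L0 R1 A3 A4 one_carrier_mat ZQ _ Q]) simp
  moreover have "A3 * 1\<^sub>m \<rho> + A4 * 0\<^sub>m \<nu> \<rho> = 0\<^sub>m 0 \<rho>" "A3 * (Z * Q) + A4 * Q = 0\<^sub>m 0 \<nu>"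
    using A3 A4 Q ZQ by (auto intro!: eq_matI)
  moreover have "L0 * 1\<^sub>m \<rho> + R1 * 0\<^sub>m \<nu> \<rho> = L0"
    using L0 R1 by simp
  ultimately have "A * N = L0 @\<^sub>c (P * (R1 * Q))"
    unfolding append_cols_def carrier_matD(2)[OF L0] carrier_matD(2)[OF PRQ] by simp
  also have "\<dots> = L @\<^sub>c 0\<^sub>m m (\<nu> - k)"
    unfolding L W' by (rule append_cols_assoc[OF L0 Lp z, symmetric])
  also have "\<nu> - k = n - dim_col L"
    by (simp add: dL n)
  finally show "A * N = L @\<^sub>c 0\<^sub>m m (n - dim_col L)" .
qed

section \<open>Polynomial matrices and conjugation by diagonal powers\<close>

lemma det_map_to_fract: "det (map_mat to_fract A) = to_fract (det A)"
proof -
  interpret comm_ring_hom to_fract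
    by unfold_locales auto
  show ?thesis
    by (rule hom_det)
qed

lemma map_mat_to_fract_mult:
  assumes "A \<in> carrier_mat m n" "B \<in> carrier_mat n p"
  shows "map_mat to_fract (A * B) = map_mat to_fract A * map_mat to_fract B"
proof -
  interpret comm_ring_hom to_fract
    by unfold_locales auto
  show ?thesis
    by (rule mat_hom_mult[OF assms])
qed

lemma const_mat_eq_map_to_fract: "const_mat A = map_mat to_fract (map_mat (\<lambda>c. [:c:]) A)"
  by (auto simp: const_mat_def)

lemma det_const_mat: "det (const_mat A) = to_fract [:det A:]"
proof -
  interpret comm_ring_hom "\<lambda>c :: complex. [:c:]"
    by unfold_locales (auto simp: one_pCons)
  show ?thesis
    by (simp add: const_mat_eq_map_to_fract det_map_to_fract)
qed

text \<open>\<open>G\<close> is \<open>D^-1 N D\<close>, with entries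
  \<open>N_ij x^(c_j - c_i)\<close>. The hypothesis \<open>mono\<close> rules out negative exponents
  at nonzero entries, and conjugation preserves the determinant, a nonzero constant.\<close>

lemma conjugate_diag_unimodular:
  assumes N: "N \<in> carrier_mat n n" and det: "det N \<noteq> 0"
    and mono: "\<And>i j. i < n \<Longrightarrow> j < n \<Longrightarrow> N $$ (i, j) \<noteq> 0 \<Longrightarrow> c i \<le> c j"
  obtains G where "G \<in> carrier_mat n n" "unimodular G"
    "const_mat N * mat_diag n (\<lambda>j. shifted_var z ^ c j) = mat_diag n (\<lambda>j. shifted_var z ^ c j) * map_mat to_fract G"
proof -
  let ?D = "mat_diag n (\<lambda>j. shifted_var z ^ c j)"
  \<comment> \<open>The truncated difference is harmless: where \<open>c j < c i\<close>, the entry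
    of \<open>N\<close> is 0 by \<open>mono\<close>.\<close>
  define G where "G = mat n n (\<lambda>(i, j). [:N $$ (i, j):] * [:- z, 1:] ^ (c j - c i))"
  have G: "G \<in> carrier_mat n n"
    by (simp add: G_def)
  have eq: "const_mat N * ?D = ?D * map_mat to_fract G"
  proof (rule eq_matI)
    fix i j assume "i < dim_row (?D * map_mat to_fract G)" "j < dim_col (?D * map_mat to_fract G)"
    then have ij: "i < n" "j < n"
      using G by (auto simp: mat_diag_def)
    have "shifted_var z ^ c j = shifted_var z ^ c i * shifted_var z ^ (c j - c i)" if "c i \<le> c j"
      using that by (simp flip: power_add)
    then have "to_fract [:N $$ (i, j):] * shifted_var z ^ c j
        = shifted_var z ^ c i * to_fract ([:N $$ (i, j):] * [:- z, 1:] ^ (c j - c i))"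
      using mono[OF ij] by (cases "N $$ (i, j) = 0") (simp_all only: to_fract_mult shifted_var_power mult_ac, simp_all)
    then show "(const_mat N * ?D) $$ (i, j) = (?D * map_mat to_fract G) $$ (i, j)"
      using ij N G by (simp add: mat_diag_mult_right[of _ n n] mat_diag_mult_left[of _ n n] G_def const_mat_def del: to_fract_mult mult_pCons_left)
  qed (use N G in \<open>auto simp: mat_diag_def\<close>)
  have D: "?D \<in> carrier_mat n n"
    by simp
  have "det ?D * det (mat_diag n (\<lambda>j. inverse (shifted_var z ^ c j))) = 1"
    by (subst det_mult[of _ n, symmetric]) auto
  then have "det ?D \<noteq> 0"
    by auto
  moreover have "det (const_mat N) * det ?D = det ?D * det (map_mat to_fract G)"
    using arg_cong[OF eq, of det] N G D det_mult[of "const_mat N" n ?D] det_mult[of ?D n "map_mat to_fract G"] by simp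
  ultimately have "to_fract (det G) = to_fract [:det N:]"
    by (simp add: det_const_mat det_map_to_fract)
  then have "det G = [:det N:]"
    by (simp only: to_fract_eq_iff)
  then have "unimodular G"
    using G det by (auto simp: unimodular_def)
  then show thesis
    using that G eq by blast
qed

lemma unimodular_mult:
  assumes "A \<in> carrier_mat n n" "B \<in> carrier_mat n n" "unimodular A" "unimodular B"
  shows "unimodular (A * B)"
proof -
  obtain a b where ab: "a \<noteq> 0" "det A = [:a:]" "b \<noteq> 0" "det B = [:b:]"
    using assms by (auto simp: unimodular_def)
  then have "det (A * B) = [:a * b:]"
    using det_mult[OF assms(1,2)] by simp
  then show ?thesis
    using ab assms by (auto simp: unimodular_def)
qed

subsection \<open>Regularity and the number of structural indices\<close>

lemma ratfun_eval_shifted_var_power_mult: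
  assumes "no_pole_at z f"
  shows "ratfun_eval z (shifted_var z ^ Suc t * f) = 0"
  unfolding ratfun_eval_mult[OF no_pole_at_shifted_var_power assms] ratfun_eval_shifted_var_power by simp

text \<open>
  If \<open>w\<close> had a pole at \<open>z\<close>, its leading Laurent coefficient would be a nonzero kernel vector
  of \<open>F(z)\<close>.
\<close>

lemma no_pole_at_of_mult:
  assumes F: "F \<in> carrier_mat m p" "no_pole_mat z F" and w: "w \<in> carrier_vec p"
    and Fw: "\<And>i. i < m \<Longrightarrow> no_pole_at z ((F *\<^sub>v w) $ i)"
    and tail: "\<And>j. \<rho> \<le> j \<Longrightarrow> j < p \<Longrightarrow> no_pole_at z (w $ j)"
    and uniq: "\<And>v. v \<in> carrier_vec p \<Longrightarrow> (\<And>j. \<rho> \<le> j \<Longrightarrow> j < p \<Longrightarrow> v $ j = 0) \<Longrightarrow>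
      eval_mat z F *\<^sub>v v = 0\<^sub>v m \<Longrightarrow> v = 0\<^sub>v p"
  shows "\<forall>j<p. no_pole_at z (w $ j)"
proof -
  let ?x = "shifted_var z"
  \<comment> \<open>\<open>t\<close> is any common bound of the pole orders, not the exact one. If
    it is not sharp, the vector \<open>v\<close> below is zero anyway and the bound still
    drops.\<close>
  have descent: "\<forall>j<p. no_pole_at z (w $ j)" if "\<forall>j<p. no_pole_at z (?x ^ t * w $ j)" for t
    using that
  proof (induction t)
    case (Suc t)
    define u where "u j = ?x ^ Suc t * w $ j" for j
    have u: "no_pole_at z (u j)" if "j < p" for j
      using Suc.prems that by (simp add: u_def)
    define v where "v = vec p (\<lambda>j. ratfun_eval z (u j))"
    have v: "v \<in> carrier_vec p"
      by (simp add: v_def)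
    \<comment> \<open>Entries from \<rho> on are pole-free already, so the factor
      \<open>?x ^ Suc t\<close> makes them vanish at \<open>z\<close>. That is why
      \<open>uniq\<close> is required only for vectors supported on the first \<rho>
      entries.\<close>
    have "v $ j = 0" if "\<rho> \<le> j" "j < p" for j
      using that ratfun_eval_shifted_var_power_mult[OF tail[OF that]]
      by (simp add: v_def u_def del: power_Suc)
    moreover have "eval_mat z F *\<^sub>v v = 0\<^sub>v m"
    proof (rule eq_vecI)
      fix i assume "i < dim_vec (0\<^sub>v m :: complex vec)"
      then have i: "i < m"
        by simp
      have "(eval_mat z F *\<^sub>v v) $ i = (\<Sum>j<p. eval_mat z F $$ (i, j) * v $ j)"
        by (rule mat_mult_vec_index[OF eval_mat_carrier[OF F(1)] v i])
      also have "\<dots> = (\<Sum>j<p. ratfun_eval z (F $$ (i, j) * u j))"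
        using F i u by (intro sum.cong) (auto simp: v_def no_pole_mat_iff ratfun_eval_mult)
      also have "\<dots> = ratfun_eval z (\<Sum>j<p. F $$ (i, j) * u j)"
        using F i u by (intro ratfun_eval_sum[symmetric]) (auto simp: no_pole_mat_iff intro!: no_pole_at_mult)
      also have "(\<Sum>j<p. F $$ (i, j) * u j) = ?x ^ Suc t * (F *\<^sub>v w) $ i"
        unfolding mat_mult_vec_index[OF F(1) w i] u_def sum_distrib_left by (simp add: mult_ac)
      also have "ratfun_eval z \<dots> = 0"
        by (rule ratfun_eval_shifted_var_power_mult[OF Fw[OF i]])
      finally show "(eval_mat z F *\<^sub>v v) $ i = 0\<^sub>v m $ i"
        using i by simp
    qed (use F in auto)
    ultimately have v0: "v = 0\<^sub>v p"
      using uniq[OF v] by blast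
    have "no_pole_at z (?x ^ t * w $ j)" if j: "j < p" for j
    proof -
      have "ratfun_eval z (u j) = v $ j"
        using j by (simp add: v_def)
      then have "ratfun_eval z (u j) = 0"
        using j by (simp add: v0)
      then have "no_pole_at z (u j / ?x)"
        by (rule no_pole_at_divide_shifted_var[OF u[OF j]])
      moreover have "u j / ?x = ?x ^ t * w $ j"
        by (simp add: u_def)
      ultimately show ?thesis
        by simp
    qed
    then show ?case
      using Suc.IH by blast
  qed simp
  \<comment> \<open>The sum is a crude common bound that, unlike a maximum, also makes sense for
    \<open>p = 0\<close>.\<close>
  have "\<forall>j<p. no_pole_at z (?x ^ (\<Sum>j<p. pole_order z (w $ j)) * w $ j)"
    by (auto intro!: no_pole_at_power_mult member_le_sum[of _ "{..<p}" "\<lambda>j. pole_order z (w $ j)"])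
  then show ?thesis
    by (rule descent)
qed

text \<open>The case \<open>\<rho> = p\<close>, column by column: nothing is known about any entry
  in advance, but the whole kernel at \<open>z\<close> is trivial.\<close>

lemma no_pole_mat_of_mult:
  assumes F: "F \<in> carrier_mat m p" "no_pole_mat z F" "inj_mat (eval_mat z F)"
    and G: "G \<in> carrier_mat p q" and FG: "no_pole_mat z (F * G)"
  shows "no_pole_mat z G"
proof -
  have "\<forall>i<p. no_pole_at z (col G j $ i)" if j: "j < q" for j
  proof (rule no_pole_at_of_mult[OF F(1,2), where \<rho> = p])
    show "no_pole_at z ((F *\<^sub>v col G j) $ i)" if "i < m" for i
      using FG F(1) G j that by (simp add: no_pole_mat_iff)
    show "v = 0\<^sub>v p" if "v \<in> carrier_vec p" "eval_mat z F *\<^sub>v v = 0\<^sub>v m" for v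
      using inj_matD[OF F(3) eval_mat_carrier[OF F(1)] that] .
  qed (use G j in auto)
  then show ?thesis
    using G by (auto simp: no_pole_mat_iff)
qed

lemma unimodular_det_eval:
  assumes "P \<in> carrier_mat n n" "unimodular P"
  shows "no_pole_mat z (map_mat to_fract P)" "det (map_mat to_fract P) \<noteq> 0"
    "det (eval_mat z (map_mat to_fract P)) \<noteq> 0"
proof -
  obtain c where c: "c \<noteq> 0" "det P = [:c:]"
    using assms by (auto simp: unimodular_def)
  show np: "no_pole_mat z (map_mat to_fract P)"
    by (simp add: no_pole_mat_iff)
  show "det (map_mat to_fract P) \<noteq> 0"
    using c by (simp add: det_map_to_fract)
  show "det (eval_mat z (map_mat to_fract P)) \<noteq> 0"
    using det_eval_mat[OF _ np, of n] assms c by (simp add: det_map_to_fract)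
qed

text \<open>With \<open>T\<close> the quotient over the field, \<open>A * T = B\<close> is
  pole-free, and a left factor injective at \<open>z\<close> can be cancelled. No formula for the
  inverse of \<open>A\<close> is involved.\<close>

lemma no_pole_left_quotient:
  assumes A: "A \<in> carrier_mat n n" "no_pole_mat z A" "det (eval_mat z A) \<noteq> 0"
    and B: "B \<in> carrier_mat n p" "no_pole_mat z B"
  obtains T where "T \<in> carrier_mat n p" "A * T = B" "no_pole_mat z T"
proof -
  have "det A \<noteq> 0"
    using det_eval_mat[OF A(1,2)] A(3) by auto
  then obtain Ai where Ai: "Ai \<in> carrier_mat n n" "A * Ai = 1\<^sub>m n"
    using invertible_of_det_nonzero[OF A(1)] by blast
  have AAB: "A * (Ai * B) = B"
    using assoc_mult_mat[OF A(1) Ai(1) B(1)] Ai(2) left_mult_one_mat[OF B(1)] by simp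
  have "inj_mat (eval_mat z A)"
    using inj_mat_iff_det[OF eval_mat_carrier[OF A(1)]] A(3) by simp
  then have "no_pole_mat z (Ai * B)"
    using no_pole_mat_of_mult[OF A(1,2) _ mult_carrier_mat[OF Ai(1) B(1)]] AAB B(2) by simp
  then show thesis
    using that[OF mult_carrier_mat[OF Ai(1) B(1)] AAB] by simp
qed

text \<open>
  With \<open>S = M R K\<close> the local Smith form and \<open>C = M B\<close>, one has \<open>C D = S T\<close> and \<open>S = C D T'\<close> for
  pole-free \<open>T, T'\<close>. The first identity kills the rows of \<open>C(z)\<close> beyond \<open>q\<close>, so \<open>\<rho>' \<le> q\<close>; the second
  writes the first \<open>q\<close> unit vectors as combinations of the columns of \<open>M(z) L\<close>, so \<open>q \<le> \<rho>'\<close>.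
\<close>

lemma dim_col_eq_count:
  fixes s c :: "nat \<Rightarrow> nat"
  assumes M: "M \<in> carrier_mat m m" "no_pole_mat z M" "det (eval_mat z M) \<noteq> 0"
    and K: "K \<in> carrier_mat n n" "no_pole_mat z K" "det (eval_mat z K) \<noteq> 0"
    and R: "R \<in> carrier_mat m n"
    and MRK: "M * R * K = Matrix.mat m n (\<lambda>(k, j). if k = j \<and> k < r then shifted_var z ^ s k else 0)"
    and rm: "r \<le> m" and rn: "r \<le> n" and q: "q \<le> r" "\<And>k. k < r \<Longrightarrow> s k \<le> i \<longleftrightarrow> k < q"
    and P: "P \<in> carrier_mat n n" "unimodular P"
    and B: "B \<in> carrier_mat m n" "no_pole_mat z B"
    and RP: "R * map_mat to_fract P = B * mat_diag n (\<lambda>j. shifted_var z ^ c j)"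
    and L: "L \<in> carrier_mat m \<rho>'" "inj_mat L" and BL: "eval_mat z B = L @\<^sub>c 0\<^sub>m m (n - \<rho>')"
    and rho: "\<rho> \<le> \<rho>'" "\<rho>' \<le> n"
    and c: "\<And>j. j < n \<Longrightarrow> c j \<le> i" "\<And>j. \<rho> \<le> j \<Longrightarrow> j < n \<Longrightarrow> c j = i"
  shows "\<rho>' = q"
proof -
  let ?x = "shifted_var z" and ?S = "M * R * K"
  define V where "V = map_mat to_fract P"
  have V: "V \<in> carrier_mat n n" "no_pole_mat z V" "det (eval_mat z V) \<noteq> 0"
    using unimodular_det_eval[OF P] P(1) by (auto simp: V_def)
  define D where "D = mat_diag n (\<lambda>j. ?x ^ c j)"
  have D: "D \<in> carrier_mat n n"
    by (simp add: D_def)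
  define C where "C = M * B"
  have C: "C \<in> carrier_mat m n"
    using M B by (auto simp: C_def)
  have C': "no_pole_mat z C"
    unfolding C_def by (rule no_pole_mat_mult[OF M(1) B(1) M(2) B(2)])
  have MR: "M * R \<in> carrier_mat m n" and S: "?S \<in> carrier_mat m n"
    using M R K by auto
  have CD: "C * D = M * R * V"
    unfolding C_def using RP assoc_mult_mat[OF M(1) B(1) D] assoc_mult_mat[OF M(1) R V(1)]
    by (simp add: V_def D_def)
  define Y where "Y = eval_mat z M * L"
  have Y: "Y \<in> carrier_mat m \<rho>'"
    unfolding Y_def using M(1) L(1) by (intro mult_carrier_mat) auto
  have injY: "inj_mat Y"
    unfolding Y_def using M L inj_mat_iff_det[of "eval_mat z M" m] by (intro inj_mat_mult[of _ m m _ \<rho>']) auto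
  have evalB: "eval_mat z B $$ (k, j) = (if j < \<rho>' then L $$ (k, j) else 0)" if "k < m" "j < n" for k j
    using that rho by (simp add: BL append_cols_index[OF L(1) zero_carrier_mat])
  have evalC: "eval_mat z C $$ (k, j) = (if j < \<rho>' then Y $$ (k, j) else 0)" if kj: "k < m" "j < n" for k j
  proof -
    have "eval_mat z C $$ (k, j) = (eval_mat z M * eval_mat z B) $$ (k, j)"
      unfolding C_def by (simp only: eval_mat_mult[OF M(1) B(1) M(2) B(2)])
    also have "\<dots> = (\<Sum>l<m. eval_mat z M $$ (k, l) * eval_mat z B $$ (l, j))"
      by (rule mat_mult_index[OF eval_mat_carrier[OF M(1)] eval_mat_carrier[OF B(1)] kj])
    also have "\<dots> = (\<Sum>l<m. eval_mat z M $$ (k, l) * (if j < \<rho>' then L $$ (l, j) else 0))"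
      by (rule sum.cong) (auto simp only: evalB[OF _ kj(2)] lessThan_iff)
    also have "\<dots> = (if j < \<rho>' then Y $$ (k, j) else 0)"
      using mat_mult_index[OF eval_mat_carrier[OF M(1)] L(1) kj(1), of j] by (simp add: Y_def del: index_mult_mat)
    finally show ?thesis .
  qed
  have Sidx: "?S $$ (k, j) = (if k = j \<and> k < r then ?x ^ s k else 0)" if "k < m" "j < n" for k j
    unfolding MRK using that by simp

  have "\<rho>' \<le> q"
  proof -
    \<comment> \<open>\<open>K\<close> and \<open>V\<close> are both invertible at \<open>z\<close>,
      so each is a pole-free right multiple of the other. This compares the Smith form with the run
      of the search.\<close>
    obtain T where T: "T \<in> carrier_mat n n" "K * T = V" "no_pole_mat z T"
      using no_pole_left_quotient[OF K V(1,2)] .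
    have CDST: "C * D = ?S * T"
      unfolding CD T(2)[symmetric] by (rule assoc_mult_mat[OF MR K(1) T(1), symmetric])
    have zero: "Y $$ (k, j) = 0" if k: "q \<le> k" "k < m" and j: "j < \<rho>'" for k j
    proof -
      have jn: "j < n"
        using j rho by simp
      have "C $$ (k, j) * ?x ^ c j = (C * D) $$ (k, j)"
        using k jn by (simp add: D_def mat_diag_mult_right[OF C])
      also have "\<dots> = (\<Sum>l<n. ?S $$ (k, l) * T $$ (l, j))"
        unfolding CDST by (rule mat_mult_index[OF S T(1) k(2) jn])
      also have "\<dots> = (\<Sum>l<n. if l = k then (if k < r then ?x ^ s k * T $$ (k, j) else 0) else 0)"
        by (rule sum.cong) (auto simp: Sidx[OF k(2)] simp del: index_mult_mat)
      finally have eq: "C $$ (k, j) * ?x ^ c j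
          = (if k < n \<and> k < r then ?x ^ s k * T $$ (k, j) else 0)"
        by (simp add: sum.delta')
      \<comment> \<open>For \<open>q \<le> k < r\<close> one has \<open>c j \<le> i < s k\<close>,
        so a positive power of \<open>?x\<close> survives the cancellation of
        \<open>?x ^ c j\<close>. For \<open>k \<ge> r\<close> the row of \<open>?S\<close> is
        zero.\<close>
      have "ratfun_eval z (C $$ (k, j)) = 0"
      proof (cases "k < n \<and> k < r")
        case True
        have "c j < s k"
          using q(2)[of k] True k(1) c(1)[OF jn] by auto
        then have "?x ^ s k = ?x ^ c j * ?x ^ (s k - c j)"
          by (simp flip: power_add)
        then have "?x ^ c j * C $$ (k, j) = ?x ^ c j * (?x ^ (s k - c j) * T $$ (k, j))"
          using eq True by (simp add: mult_ac)
        then have Ckj: "C $$ (k, j) = ?x ^ (s k - c j) * T $$ (k, j)"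
          by simp
        have "no_pole_at z (T $$ (k, j))"
          using T(1,3) True jn by (auto simp: no_pole_mat_iff)
        then show ?thesis
          using \<open>c j < s k\<close> by (simp add: Ckj ratfun_eval_mult)
      next
        case False
        have "C $$ (k, j) = 0"
          using eq unfolding if_not_P[OF False] by simp
        then show ?thesis
          by simp
      qed
      then show ?thesis
        using evalC[OF k(2) jn] j jn k C by simp
    qed
    \<comment> \<open>Since the rows of \<open>Y\<close> from \<open>q\<close> on vanish, its first
      \<open>q\<close> rows alone have a trivial kernel.\<close>
    define U where "U = Matrix.mat q \<rho>' (($$) Y)"
    have U: "U \<in> carrier_mat q \<rho>'"
      by (simp add: U_def)
    have "inj_mat U"
    proof (rule inj_matI[OF U])
      fix v :: "complex vec" assume v: "v \<in> carrier_vec \<rho>'" "U *\<^sub>v v = 0\<^sub>v q"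
      have "Y *\<^sub>v v = 0\<^sub>v m"
      proof (rule eq_vecI)
        fix k assume "k < dim_vec (0\<^sub>v m :: complex vec)"
        then have k: "k < m"
          by simp
        have "(Y *\<^sub>v v) $ k = (\<Sum>j<\<rho>'. Y $$ (k, j) * v $ j)"
          by (rule mat_mult_vec_index[OF Y v(1) k])
        also have "\<dots> = 0"
        proof (cases "k < q")
          case True
          have "(\<Sum>j<\<rho>'. Y $$ (k, j) * v $ j) = (\<Sum>j<\<rho>'. U $$ (k, j) * v $ j)"
            using True by (intro sum.cong) (auto simp: U_def)
          also have "\<dots> = (U *\<^sub>v v) $ k"
            by (rule mat_mult_vec_index[OF U v(1) True, symmetric])
          finally show ?thesis
            using v(2) True by simp
        qed (simp add: zero k)
        finally show "(Y *\<^sub>v v) $ k = 0\<^sub>v m $ k"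
          using k by simp
      qed (use Y in auto)
      then show "v = 0\<^sub>v \<rho>'"
        by (rule inj_matD[OF injY Y v(1)])
    qed
    then show ?thesis
      by (rule inj_mat_dim_le[OF U])
  qed

  moreover have "q \<le> \<rho>'"
  proof -
    obtain T where T: "T \<in> carrier_mat n n" "V * T = K" "no_pole_mat z T"
      using no_pole_left_quotient[OF V K(1,2)] .
    have SCDT: "?S = C * D * T"
      unfolding CD T(2)[symmetric] by (rule assoc_mult_mat[OF MR V(1) T(1), symmetric])
    have CDc: "C * D \<in> carrier_mat m n"
      by (rule mult_carrier_mat[OF C D])
    \<comment> \<open>Dividing column \<open>k\<close> of \<open>?S = C * D * T\<close> by
      \<open>?x ^ s k\<close> solves \<open>C w = e_k\<close>. The solution could have poles where
      \<open>c j < s k\<close>.\<close>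
    define w where "w k = vec n (\<lambda>j. ?x ^ c j * T $$ (j, k) / ?x ^ s k)" for k
    have w: "w k \<in> carrier_vec n" for k
      by (simp add: w_def)
    have qn: "q \<le> n"
      using q(1) rn by simp
    have Cw: "(C *\<^sub>v w k) $ a = (if a = k then 1 else 0)" if k: "k < q" and a: "a < m" for k a
    proof -
      have kn: "k < n"
        using k qn by simp
      have "(C *\<^sub>v w k) $ a = (\<Sum>j<n. C $$ (a, j) * w k $ j)"
        by (rule mat_mult_vec_index[OF C w a])
      also have "\<dots> = (\<Sum>j<n. (C * D) $$ (a, j) * T $$ (j, k)) / ?x ^ s k"
        unfolding sum_divide_distrib
        by (rule sum.cong) (use a in \<open>auto simp: w_def D_def mat_diag_mult_right[OF C] mult_ac\<close>)
      also have "(\<Sum>j<n. (C * D) $$ (a, j) * T $$ (j, k)) = ?S $$ (a, k)"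
        unfolding SCDT by (rule mat_mult_index[OF CDc T(1) a kn, symmetric])
      also have "\<dots> / ?x ^ s k = (if a = k then 1 else 0)"
        unfolding Sidx[OF a kn] using k q(1) by auto
      finally show ?thesis .
    qed
    have wreg: "no_pole_at z (w k $ j)" if k: "k < q" and j: "j < n" for k j
    proof -
      have "\<forall>j<n. no_pole_at z (w k $ j)"
      \<comment> \<open>The old \<rho> is the right threshold: beyond it
        \<open>c j = i \<ge> s k\<close>, so no pole arises. A kernel vector supported before it
        involves only columns of \<open>Y\<close>, as \<open>\<rho> \<le> \<rho>'\<close>, and these
        are independent.\<close>
      proof (rule no_pole_at_of_mult[OF C C' w, where \<rho> = \<rho>])
        show "no_pole_at z ((C *\<^sub>v w k) $ a)" if "a < m" for a
          unfolding Cw[OF k that] by simp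
      next
        fix j assume j: "\<rho> \<le> j" "j < n"
        have "s k \<le> c j"
          using c(2)[OF j] q k by auto
        then have "?x ^ c j = ?x ^ s k * ?x ^ (c j - s k)"
          by (simp flip: power_add)
        then have wkj: "w k $ j = ?x ^ (c j - s k) * T $$ (j, k)"
          using j by (simp add: w_def)
        have "no_pole_at z (T $$ (j, k))"
          using T(1,3) j k qn by (auto simp: no_pole_mat_iff)
        then show "no_pole_at z (w k $ j)"
          unfolding wkj by (simp add: no_pole_at_mult)
      next
        fix v assume v: "v \<in> carrier_vec n" "\<And>j. \<rho> \<le> j \<Longrightarrow> j < n \<Longrightarrow> v $ j = 0"
          "eval_mat z C *\<^sub>v v = 0\<^sub>v m"
        define v' where "v' = vec \<rho>' (($) v)"
        have v': "v' \<in> carrier_vec \<rho>'"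
          by (simp add: v'_def)
        have "Y *\<^sub>v v' = 0\<^sub>v m"
        proof (rule eq_vecI)
          fix a assume "a < dim_vec (0\<^sub>v m :: complex vec)"
          then have a: "a < m"
            by simp
          have "(Y *\<^sub>v v') $ a = (\<Sum>j<\<rho>'. Y $$ (a, j) * v' $ j)"
            by (rule mat_mult_vec_index[OF Y v' a])
          also have "\<dots> = (\<Sum>j<\<rho>'. eval_mat z C $$ (a, j) * v $ j)"
            using rho by (intro sum.cong) (auto simp: v'_def evalC[OF a] simp del: eval_mat_index)
          also have "\<dots> = (\<Sum>j<n. eval_mat z C $$ (a, j) * v $ j)"
            using rho v(2) by (intro sum.mono_neutral_left) (auto simp del: eval_mat_index)
          also have "\<dots> = (eval_mat z C *\<^sub>v v) $ a"
            by (rule mat_mult_vec_index[OF eval_mat_carrier[OF C] v(1) a, symmetric])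
          finally show "(Y *\<^sub>v v') $ a = 0\<^sub>v m $ a"
            using v(3) by simp
        qed (use Y in auto)
        then have "v' = 0\<^sub>v \<rho>'"
          by (rule inj_matD[OF injY Y v'])
        then have "v $ j = 0" if "j < \<rho>'" for j
          using that by (metis index_vec index_zero_vec(1) v'_def)
        then show "v = 0\<^sub>v n"
          using v(1,2) rho by (intro eq_vecI) (auto, metis le_trans not_le)
      qed
      then show ?thesis
        using j by simp
    qed
    \<comment> \<open>\<open>C w_k = e_k\<close> can now be evaluated at \<open>z\<close>. Columns
      of \<open>C\<close> from \<open>\<rho>'\<close> on vanish there, so the first
      \<open>\<rho>'\<close> entries of each \<open>w_k\<close> suffice.\<close>
    define W where "W = Matrix.mat \<rho>' q (\<lambda>(j, k). ratfun_eval z (w k $ j))"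
    have W: "W \<in> carrier_mat \<rho>' q"
      by (simp add: W_def)
    have YW: "(Y * W) $$ (a, k) = (if a = k then 1 else 0)" if a: "a < m" and k: "k < q" for a k
    proof -
      have "(Y * W) $$ (a, k) = (\<Sum>j<\<rho>'. Y $$ (a, j) * W $$ (j, k))"
        by (rule mat_mult_index[OF Y W a k])
      also have "\<dots> = (\<Sum>j<\<rho>'. eval_mat z C $$ (a, j) * ratfun_eval z (w k $ j))"
        using rho k by (intro sum.cong) (auto simp: W_def evalC[OF a] simp del: eval_mat_index)
      also have "\<dots> = (\<Sum>j<n. eval_mat z C $$ (a, j) * ratfun_eval z (w k $ j))"
        using rho by (intro sum.mono_neutral_left) (auto simp: evalC[OF a] simp del: eval_mat_index)
      also have "\<dots> = (\<Sum>j<n. ratfun_eval z (C $$ (a, j) * w k $ j))"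
        using C C' a wreg[OF k] by (intro sum.cong) (auto simp: no_pole_mat_iff ratfun_eval_mult)
      also have "\<dots> = ratfun_eval z (\<Sum>j<n. C $$ (a, j) * w k $ j)"
        using C C' a wreg[OF k]
        by (intro ratfun_eval_sum[symmetric]) (auto simp: no_pole_mat_iff intro!: no_pole_at_mult)
      also have "(\<Sum>j<n. C $$ (a, j) * w k $ j) = (C *\<^sub>v w k) $ a"
        by (rule mat_mult_vec_index[OF C w a, symmetric])
      finally show ?thesis
        by (simp add: Cw[OF k a])
    qed
    have "inj_mat W"
    proof (rule inj_matI[OF W])
      fix u :: "complex vec" assume u: "u \<in> carrier_vec q" "W *\<^sub>v u = 0\<^sub>v \<rho>'"
      have YWu: "Y * W *\<^sub>v u = 0\<^sub>v m"
        using assoc_mult_mat_vec[OF Y W u(1)] u(2) mat_mult_zero_vec[OF Y] by simp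
      show "u = 0\<^sub>v q"
      proof (rule eq_vecI)
        fix k assume "k < dim_vec (0\<^sub>v q :: complex vec)"
        then have k: "k < q" and km: "k < m"
          using q(1) rm by auto
        have "(\<Sum>j<q. (Y * W) $$ (k, j) * u $ j) = (\<Sum>j<q. if j = k then u $ j else 0)"
          by (rule sum.cong) (auto simp: YW[OF km] simp del: index_mult_mat)
        also have "\<dots> = u $ k"
          using k by simp
        finally have "u $ k = (Y * W *\<^sub>v u) $ k"
          using mat_mult_vec_index[OF mult_carrier_mat[OF Y W] u(1) km] by simp
        then show "u $ k = 0\<^sub>v q $ k"
          using k km by (simp add: YWu del: index_mult_mat_vec)
      qed (use u in auto)
    qed
    then show ?thesis
      by (rule inj_mat_dim_le[OF W])
  qed
  ultimately show ?thesis
    by simp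
qed

subsection \<open>The state of the search\<close>

text \<open>The invariant on entering step \<open>i\<close>: \<open>A\<close> is the current matrix,
  \<open>T\<close> the product of all factors so far, and \<open>c j\<close> the number of times
  column \<open>j\<close> has been divided. Restoring these divisions makes \<open>T\<close>
  polynomial and unimodular. The last clause says that an unselected column was divided at every
  step.\<close>

definition search_state ::
  "complex \<Rightarrow> ratfun mat \<Rightarrow> nat \<Rightarrow> ratfun mat \<Rightarrow> nat \<Rightarrow> (nat \<Rightarrow> nat) \<Rightarrow> ratfun mat \<Rightarrow> bool" where
  "search_state z R i A \<rho> c T \<longleftrightarrow>
     (let m = dim_row R; n = dim_col R in
       A \<in> carrier_mat m n \<and> no_pole_mat z A \<and> \<rho> \<le> n \<and>
       inj_mat (Matrix.mat m \<rho> (($$) (eval_mat z A))) \<and>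
       T \<in> carrier_mat n n \<and> A = R * T \<and>
       (\<exists>P \<in> carrier_mat n n. unimodular P \<and>
         T * mat_diag n (\<lambda>j. shifted_var z ^ c j) = map_mat to_fract P) \<and>
       (\<forall>j < n. c j \<le> i \<and> (\<rho> \<le> j \<longrightarrow> c j = i)))"

lemma search_state_initial:
  assumes R: "R \<in> carrier_mat m n" "no_pole_mat z R"
  shows "search_state z R 0 R 0 (\<lambda>j. 0) (1\<^sub>m n)"
proof -
  have inj: "inj_mat (Matrix.mat m 0 (($$) (eval_mat z R)))"
    by (rule inj_matI[of _ m 0]) auto
  have "unimodular (1\<^sub>m n)"
    by (auto simp: unimodular_def one_pCons)
  moreover have "1\<^sub>m n * mat_diag n (\<lambda>j. shifted_var z ^ 0) = map_mat to_fract (1\<^sub>m n :: complex poly mat)"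
    by (simp, rule eq_matI) auto
  ultimately have "\<exists>P \<in> carrier_mat n n. unimodular P \<and>
      1\<^sub>m n * mat_diag n (\<lambda>j. shifted_var z ^ 0) = map_mat to_fract P"
    using one_carrier_mat by blast
  moreover have "dim_row R = m" "dim_col R = n" "R = R * 1\<^sub>m n"
    using R by auto
  ultimately show ?thesis
    using inj R unfolding search_state_def Let_def by (intro conjI) simp_all
qed

text \<open>Half a step: \<open>N\<close> has been applied but nothing divided yet, so the exponents
  are still the old ones. The columns are counted at this point, and the last step of the search
  ends here.\<close>

lemma search_state_step:
  assumes R: "R \<in> carrier_mat m n" and state: "search_state z R i A \<rho> c T"
    and step: "toeplitz_step (eval_mat z A) \<rho> N L"
  shows "\<rho> \<le> dim_col L" "dim_col L \<le> n" "L \<in> carrier_mat m (dim_col L)" "inj_mat L"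
    "N \<in> carrier_mat n n"
    "A * const_mat N \<in> carrier_mat m n" "no_pole_mat z (A * const_mat N)"
    "eval_mat z (A * const_mat N) = L @\<^sub>c 0\<^sub>m m (n - dim_col L)"
    "T * const_mat N \<in> carrier_mat n n" "A * const_mat N = R * (T * const_mat N)"
    "\<exists>P \<in> carrier_mat n n. unimodular P \<and>
       T * const_mat N * mat_diag n (\<lambda>j. shifted_var z ^ c j) = map_mat to_fract P"
proof -
  have A: "A \<in> carrier_mat m n" "no_pole_mat z A" and rho: "\<rho> \<le> n"
    and inj: "inj_mat (Matrix.mat m \<rho> (($$) (eval_mat z A)))" and T: "T \<in> carrier_mat n n"
    and ART: "A = R * T" and c: "\<And>j. j < n \<Longrightarrow> c j \<le> i" "\<And>j. j < n \<Longrightarrow> \<rho> \<le> j \<Longrightarrow> c j = i"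
    using state R unfolding search_state_def Let_def by auto
  obtain P where P: "P \<in> carrier_mat n n" "unimodular P"
      "T * mat_diag n (\<lambda>j. shifted_var z ^ c j) = map_mat to_fract P"
    using state R unfolding search_state_def Let_def by auto
  note spec = toeplitz_step_spec[OF eval_mat_carrier[OF A(1)] rho inj step]
  show "\<rho> \<le> dim_col L" "dim_col L \<le> n" "L \<in> carrier_mat m (dim_col L)" "inj_mat L"
    and N: "N \<in> carrier_mat n n"
    by (rule spec)+
  have cN: "const_mat N \<in> carrier_mat n n"
    using N by simp
  show "A * const_mat N \<in> carrier_mat m n"
    by (rule mult_carrier_mat[OF A(1) cN])
  show "no_pole_mat z (A * const_mat N)"
    by (rule no_pole_mat_mult[OF A(1) cN A(2) no_pole_const_mat])
  show "eval_mat z (A * const_mat N) = L @\<^sub>c 0\<^sub>m m (n - dim_col L)"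
    using eval_mat_mult[OF A(1) cN A(2) no_pole_const_mat] spec(7) by simp
  show "T * const_mat N \<in> carrier_mat n n"
    by (rule mult_carrier_mat[OF T cN])
  show "A * const_mat N = R * (T * const_mat N)"
    unfolding ART by (rule assoc_mult_mat[OF R T cN])
  let ?D = "mat_diag n (\<lambda>j. shifted_var z ^ c j)"
  have D: "?D \<in> carrier_mat n n"
    by simp
  \<comment> \<open>Columns \<open>b < \<rho>\<close> of \<open>N\<close> are unit vectors, so a
    nonzero entry there lies on the diagonal; every other column has the maximal exponent
    \<open>i\<close>.\<close>
  have mono: "c a \<le> c b" if "a < n" "b < n" "N $$ (a, b) \<noteq> 0" for a b
    using that c spec(8)[of a b] by (cases "b < \<rho>") (auto split: if_splits)
  obtain G where G: "G \<in> carrier_mat n n" "unimodular G" "const_mat N * ?D = ?D * map_mat to_fract G"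
    using conjugate_diag_unimodular[OF N spec(6) mono] .
  have "T * const_mat N * ?D = T * (?D * map_mat to_fract G)"
    using assoc_mult_mat[OF T cN D] G(3) by simp
  also have "\<dots> = T * ?D * map_mat to_fract G"
    by (rule assoc_mult_mat[OF T D, symmetric]) (use G(1) in simp)
  also have "\<dots> = map_mat to_fract (P * G)"
    unfolding P(3) by (rule map_mat_to_fract_mult[OF P(1) G(1), symmetric])
  finally show "\<exists>P \<in> carrier_mat n n. unimodular P \<and> T * const_mat N * ?D = map_mat to_fract P"
    using unimodular_mult[OF P(1) G(1) P(2) G(2)] mult_carrier_mat[OF P(1) G(1)] by blast
qed

lemma lead_one_diag_carrier [simp]: "lead_one_diag n \<rho> x \<in> carrier_mat n n"
  by (simp add: lead_one_diag_def)

lemma lead_one_diag_one [simp]: "lead_one_diag n \<rho> 1 = 1\<^sub>m n"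
  by (simp add: lead_one_diag_def cong: if_cong)

text \<open>The divided columns vanish at \<open>z\<close>, so no pole appears; the leading ones are
  untouched, so their values remain the columns of \<open>L\<close>.\<close>

lemma search_state_Suc:
  fixes R :: "ratfun mat" and L :: "complex mat" and z :: complex
  defines "\<Lambda> \<equiv> lead_one_diag (dim_col R) (dim_col L) (inverse (shifted_var z))"
  assumes R: "R \<in> carrier_mat m n" and state: "search_state z R i A \<rho> c T"
    and step: "toeplitz_step (eval_mat z A) \<rho> N L"
  shows "search_state z R (Suc i) (A * const_mat N * \<Lambda>) (dim_col L)
    (\<lambda>j. c j + (if j < dim_col L then 0 else 1)) (T * const_mat N * \<Lambda>)"
proof -
  let ?x = "shifted_var z" and ?B = "A * const_mat N" and ?\<rho>' = "dim_col L"
  note s = search_state_step[OF R state step]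
  have c: "\<And>j. j < n \<Longrightarrow> c j \<le> i" "\<And>j. j < n \<Longrightarrow> \<rho> \<le> j \<Longrightarrow> c j = i"
    using state R unfolding search_state_def Let_def by auto
  have dimL: "dim_row L = m"
    by (rule carrier_matD(1)[OF s(3)])
  have Lam: "\<Lambda> \<in> carrier_mat n n"
    using R by (simp add: \<Lambda>_def)
  have BLc: "?B * \<Lambda> \<in> carrier_mat m n"
    by (rule mult_carrier_mat[OF s(6) Lam])
  have BL: "(?B * \<Lambda>) $$ (k, j) = (if j < ?\<rho>' then ?B $$ (k, j) else ?B $$ (k, j) / ?x)" if "k < m" "j < n" for k j
    using that R mat_diag_mult_right[OF s(6), of "\<lambda>j. if j < ?\<rho>' then 1 else inverse ?x"]
    by (simp add: \<Lambda>_def lead_one_diag_def divide_inverse del: index_mult_mat)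
  have npB: "no_pole_at z (?B $$ (k, j))" if "k < m" "j < n" for k j
    by (rule no_pole_matD[OF s(7,6) that])
  have evB: "ratfun_eval z (?B $$ (k, j)) = (if j < ?\<rho>' then L $$ (k, j) else 0)" if kj: "k < m" "j < n" for k j
  proof -
    have "ratfun_eval z (?B $$ (k, j)) = eval_mat z ?B $$ (k, j)"
      using s(6) kj by (intro eval_mat_index[symmetric]) auto
    also have "\<dots> = (if j < ?\<rho>' then L $$ (k, j) else 0)"
      unfolding s(8) using kj s(2) by (simp add: append_cols_index[OF s(3) zero_carrier_mat])
    finally show ?thesis .
  qed
  have np: "no_pole_mat z (?B * \<Lambda>)"
  proof (rule no_pole_matI[OF BLc])
    show "no_pole_at z ((?B * \<Lambda>) $$ (k, j))" if "k < m" "j < n" for k j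
      unfolding BL[OF that] using npB[OF that] evB[OF that] by (auto intro: no_pole_at_divide_shifted_var)
  qed
  have "Matrix.mat m ?\<rho>' (($$) (eval_mat z (?B * \<Lambda>))) = L"
  proof (rule eq_matI)
    fix k j assume "k < dim_row L" "j < dim_col L"
    then have kj: "k < m" "j < ?\<rho>'" and jn: "j < n"
      using s(2) dimL by auto
    have "Matrix.mat m ?\<rho>' (($$) (eval_mat z (?B * \<Lambda>))) $$ (k, j) = eval_mat z (?B * \<Lambda>) $$ (k, j)"
      using kj by simp
    also have "\<dots> = ratfun_eval z ((?B * \<Lambda>) $$ (k, j))"
      using BLc kj jn by (intro eval_mat_index) auto
    also have "\<dots> = L $$ (k, j)"
      unfolding BL[OF kj(1) jn] using kj evB[OF kj(1) jn] by simp
    finally show "Matrix.mat m ?\<rho>' (($$) (eval_mat z (?B * \<Lambda>))) $$ (k, j) = L $$ (k, j)" .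
  qed (simp_all add: dimL)
  then have inj: "inj_mat (Matrix.mat m ?\<rho>' (($$) (eval_mat z (?B * \<Lambda>))))"
    using s(4) by simp
  have RT: "?B * \<Lambda> = R * (T * const_mat N * \<Lambda>)"
    unfolding s(10) by (rule assoc_mult_mat[OF R s(9) Lam])
  let ?D = "mat_diag n (\<lambda>j. ?x ^ c j)"
    and ?D' = "mat_diag n (\<lambda>j. ?x ^ (c j + (if j < ?\<rho>' then 0 else 1)))"
  \<comment> \<open>The exponents gain exactly what \<Lambda> takes away, so the unimodular matrix
    of the half step remains the witness.\<close>
  have "\<Lambda> * ?D' = ?D"
    using R by (auto simp: \<Lambda>_def lead_one_diag_def intro!: arg_cong[where f = "mat_diag n"])
  then have "T * const_mat N * \<Lambda> * ?D' = T * const_mat N * ?D"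
    using assoc_mult_mat[OF s(9) Lam, of ?D' n] by simp
  moreover have "c j + (if j < ?\<rho>' then 0 else 1) \<le> Suc i"
      "?\<rho>' \<le> j \<longrightarrow> c j + (if j < ?\<rho>' then 0 else 1) = Suc i" if "j < n" for j
    using c[OF that] s(1) by auto
  ultimately show ?thesis
    using R BLc np s(2,11) inj RT mult_carrier_mat[OF s(9) Lam]
    unfolding search_state_def Let_def by (simp del: index_mult_mat)
qed

lemma search_state_dim_col:
  assumes R: "R \<in> carrier_mat m n" and state: "search_state z R i A \<rho> c T"
    and step: "toeplitz_step (eval_mat z A) \<rho> N L"
    and M: "M \<in> carrier_mat m m" "no_pole_mat z M" "det (eval_mat z M) \<noteq> 0"
    and K: "K \<in> carrier_mat n n" "no_pole_mat z K" "det (eval_mat z K) \<noteq> 0"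
    and MRK: "M * R * K = Matrix.mat m n (\<lambda>(k, j). if k = j \<and> k < r then shifted_var z ^ s k else 0)"
    and r: "r \<le> m" "r \<le> n" and q: "q \<le> r" "\<And>k. k < r \<Longrightarrow> s k \<le> i \<longleftrightarrow> k < q"
  shows "dim_col L = q"
proof -
  note st = search_state_step[OF R state step]
  have c: "\<And>j. j < n \<Longrightarrow> c j \<le> i" "\<And>j. \<rho> \<le> j \<Longrightarrow> j < n \<Longrightarrow> c j = i"
    using state R unfolding search_state_def Let_def by auto
  let ?D = "mat_diag n (\<lambda>j. shifted_var z ^ c j)"
  obtain P where P: "P \<in> carrier_mat n n" "unimodular P" "T * const_mat N * ?D = map_mat to_fract P"
    using st(11) by blast
  show ?thesis
  proof (rule dim_col_eq_count[where c = c and s = s and i = i and \<rho> = \<rho>,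
        OF M K R MRK r q(1) _ P(1,2) st(6,7) _ st(3,4,8,1,2)])
    show "R * map_mat to_fract P = A * const_mat N * ?D"
      unfolding P(3)[symmetric] st(10) by (rule assoc_mult_mat[OF R st(9) mat_diag_dim, symmetric])
  qed (fact q(2) c)+
qed

section \<open>Products of the factors of the output matrix\<close>

lemma mat_prod_carrier:
  "set As \<subseteq> carrier_mat n n \<Longrightarrow> mat_prod n As \<in> carrier_mat n n"
  by (induction As) (auto simp: mat_prod_def intro: mult_carrier_mat)

lemma mat_prod_append:
  assumes "set As \<subseteq> carrier_mat n n" "set Bs \<subseteq> carrier_mat n n"
  shows "mat_prod n (As @ Bs) = mat_prod n As * mat_prod n Bs"
  using assms(1)
proof (induction As)
  case Nil
  then show ?case
    using left_mult_one_mat[OF mat_prod_carrier[OF assms(2)]] by (simp add: mat_prod_def)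
next
  case (Cons A As)
  have "mat_prod n ((A # As) @ Bs) = A * mat_prod n (As @ Bs)"
    by (simp add: mat_prod_def)
  also have "\<dots> = A * (mat_prod n As * mat_prod n Bs)"
    using Cons by simp
  also have "\<dots> = A * mat_prod n As * mat_prod n Bs"
    using Cons.prems assms(2) mat_prod_carrier[of _ n]
    by (intro assoc_mult_mat[of A n n _ n _ n, symmetric]) auto
  finally show ?case
    by (simp add: mat_prod_def)
qed

lemma mat_prod_snoc:
  assumes "set As \<subseteq> carrier_mat n n" "B \<in> carrier_mat n n"
  shows "mat_prod n (As @ [B]) = mat_prod n As * B"
  using mat_prod_append[of As n "[B]"] assms right_mult_one_mat[OF assms(2)]
  by (simp add: mat_prod_def)

text \<open>Identifies the trailing product of the undone divisions with the diagonal matrix of the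
  invariant: the exponent counts the steps at which column \<open>j\<close> was not yet
  selected.\<close>

lemma mat_prod_lead_one_diag:
  "mat_prod n (map (\<lambda>k. lead_one_diag n (\<rho> k) x) [0..<i])
    = mat_diag n (\<lambda>j. x ^ (\<Sum>k<i. if j < \<rho> k then 0 else 1))"
proof (induction i)
  case (Suc i)
  have "mat_prod n (map (\<lambda>k. lead_one_diag n (\<rho> k) x) [0..<Suc i])
      = mat_prod n (map (\<lambda>k. lead_one_diag n (\<rho> k) x) [0..<i]) * lead_one_diag n (\<rho> i) x"
    using mat_prod_snoc[of "map (\<lambda>k. lead_one_diag n (\<rho> k) x) [0..<i]" n "lead_one_diag n (\<rho> i) x"]
    by (simp add: image_subset_iff)
  also have "\<dots> = mat_diag n (\<lambda>j. x ^ (\<Sum>k<i. if j < \<rho> k then 0 else 1) * (if j < \<rho> i then 1 else x))"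
    unfolding Suc.IH by (simp add: lead_one_diag_def)
  also have "\<dots> = mat_diag n (\<lambda>j. x ^ (\<Sum>k<Suc i. if j < \<rho> k then 0 else 1))"
    by (rule arg_cong[where f = "mat_diag n"]) (auto simp: mult.commute)
  finally show ?case .
qed (simp add: mat_prod_def)

subsection \<open>Structural indices as a list\<close>

text \<open>Blocks with \<open>e k = 0\<close> contribute nothing on either side, so the keys may
  run through a whole interval of integers.\<close>

lemma diag_block_mat_scalar_blocks:
  "diag_block_mat (map (\<lambda>k. f k \<cdot>\<^sub>m 1\<^sub>m (e k)) ks)
    = (let xs = concat (map (\<lambda>k. replicate (e k) (f k)) ks) in mat_diag (length xs) ((!) xs))"
  for f :: "'b \<Rightarrow> 'a :: semiring_1"
proof (induction ks)
  case (Cons k ks)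
  define ys where "ys = concat (map (\<lambda>k. replicate (e k) (f k)) ks)"
  have "diag_block_mat (map (\<lambda>k. f k \<cdot>\<^sub>m 1\<^sub>m (e k)) ks) = mat_diag (length ys) ((!) ys)"
    using Cons by (simp add: ys_def Let_def)
  then have "diag_block_mat (map (\<lambda>k. f k \<cdot>\<^sub>m 1\<^sub>m (e k)) (k # ks))
      = four_block_mat (f k \<cdot>\<^sub>m 1\<^sub>m (e k)) (0\<^sub>m (e k) (length ys)) (0\<^sub>m (length ys) (e k))
          (mat_diag (length ys) ((!) ys))"
    by (simp add: Let_def mat_diag_def)
  also have "\<dots> = mat_diag (e k + length ys) ((!) (replicate (e k) (f k) @ ys))"
    by (rule eq_matI) (auto simp: mat_diag_def nth_append)
  finally show ?case
    by (simp add: ys_def Let_def)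
qed (auto simp: mat_diag_def)

text \<open>Two sorted lists with the same multiplicities coincide.\<close>

lemma concat_replicate_sorted:
  fixes xs :: "int list"
  assumes "sorted xs" "set xs \<subseteq> {a..b}"
    and e: "\<And>k. e k = card {j. j < length xs \<and> xs ! j = k}"
  shows "concat (map (\<lambda>k. replicate (e k) k) [a..b]) = xs"
proof -
  let ?ys = "\<lambda>ks. concat (map (\<lambda>k. replicate (e k) k) ks)"
  have "sorted (?ys ks)" if "sorted ks" for ks
    using that by (induction ks) (auto simp: sorted_append)
  then have sorted: "sorted (?ys [a..b])"
    by simp
  have count: "count (mset (?ys ks)) k = (if k \<in> set ks then e k else 0)" if "distinct ks" for k ks
    using that by (induction ks) auto
  have ek: "e k = count (mset xs) k" for k
    by (simp add: e count_mset count_list_eq_length_filter length_filter_conv_card eq_commute)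
  have "mset (?ys [a..b]) = mset xs"
  proof (rule multiset_eqI)
    fix k
    show "count (mset (?ys [a..b])) k = count (mset xs) k"
      using count[of "[a..b]" k] assms(2) by (auto simp: ek count_eq_zero_iff)
  qed
  then have "sort xs = ?ys [a..b]"
    using sorted by (rule properties_for_sort)
  then show ?thesis
    using assms(1) by (simp add: sorted_sort_id)
qed

lemma mult_lead_cols:
  fixes A :: "'a :: semiring_1 mat"
  assumes A: "A \<in> carrier_mat p n" and r: "r \<le> n"
  shows "A * lead_cols n r = Matrix.mat p r (($$) A)"
proof -
  have c: "(lead_cols n r :: 'a mat) \<in> carrier_mat n r"
    using carrier_append_rows[of "1\<^sub>m r :: 'a mat" r r "0\<^sub>m (n - r) r" "n - r"] r by (simp add: lead_cols_def)
  have idx: "(lead_cols n r :: 'a mat) $$ (k, j) = (if k = j then 1 else 0)" if "k < n" "j < r" for k j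
    using that r by (auto simp: lead_cols_def append_rows_def)
  have "(A * lead_cols n r) $$ (i, j) = Matrix.mat p r (($$) A) $$ (i, j)" if ij: "i < p" "j < r" for i j
  proof -
    have "(A * lead_cols n r) $$ (i, j) = (\<Sum>k<n. A $$ (i, k) * lead_cols n r $$ (k, j))"
      by (rule mat_mult_index[OF A c ij])
    also have "\<dots> = (\<Sum>k<n. if k = j then A $$ (i, k) else 0)"
      by (rule sum.cong) (use idx ij in auto)
    finally show ?thesis
      using ij r by simp
  qed
  then show ?thesis
    using A c by (intro eq_matI) (auto simp del: index_mult_mat(1))
qed

text \<open>Monotonicity makes the positions with \<open>s k \<le> i\<close> an initial segment,
  whose length is the count that \<open>dim_col L\<close> has to match.\<close>

lemma threshold_index:
  fixes s :: "nat \<Rightarrow> nat"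
  assumes "\<And>j k. j \<le> k \<Longrightarrow> k < r \<Longrightarrow> s j \<le> s k"
  obtains q where "q \<le> r" "\<And>k. k < r \<Longrightarrow> s k \<le> i \<longleftrightarrow> k < q"
proof -
  \<comment> \<open>The alternative \<open>k = r\<close> provides a minimum even if no value exceeds
    \<open>i\<close>; then \<open>q = r\<close>.\<close>
  define q where "q = (LEAST k. k = r \<or> i < s k)"
  have "q \<le> r"
    unfolding q_def by (rule Least_le) simp
  have qr: "q = r \<or> i < s q"
    unfolding q_def by (rule LeastI[of _ r]) simp
  have "s k \<le> i \<longleftrightarrow> k < q" if k: "k < r" for k
  proof
    assume "s k \<le> i"
    then show "k < q"
      using qr assms[of q k] k by (cases "k < q") auto
  next
    assume "k < q"
    then show "s k \<le> i"
      using not_less_Least[of k "\<lambda>k. k = r \<or> i < s k"] by (auto simp: q_def not_less)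
  qed
  then show thesis
    using that \<open>q \<le> r\<close> by blast
qed

text \<open>Scaling by \<open>?x ^ l\<close> adds \<open>l\<close> to every exponent of the local
  Smith form and removes all poles of \<open>R\<close> at \<open>z\<close>. The diagonal entries are
  then pole-free powers, so the shifted exponents are natural numbers.\<close>

lemma structural_indices_shift:
  assumes R: "R \<in> carrier_mat m n" and R0: "R \<noteq> 0\<^sub>m m n" and r: "r = mat_rank R"
    and l: "l = pole_order_mat z R" and si: "structural_indices z R \<sigma>"
  obtains M K s where "M \<in> carrier_mat m m" "no_pole_mat z M" "det (eval_mat z M) \<noteq> 0"
    "K \<in> carrier_mat n n" "no_pole_mat z K" "det (eval_mat z K) \<noteq> 0"
    "M * (shifted_var z ^ l \<cdot>\<^sub>m R) * K
      = Matrix.mat m n (\<lambda>(k, j). if k = j \<and> k < r then shifted_var z ^ s k else 0)"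
    "no_pole_mat z (shifted_var z ^ l \<cdot>\<^sub>m R)"
    "r \<le> m" "r \<le> n" "0 < r" "\<And>k. k < r \<Longrightarrow> int (s k) = \<sigma> ! k + int l"
proof -
  let ?x = "shifted_var z"
  obtain M K where M: "M \<in> carrier_mat m m" "no_pole_mat z M" "invertible_mat (eval_mat z M)"
    and K: "K \<in> carrier_mat n n" "no_pole_mat z K" "invertible_mat (eval_mat z K)"
    and MRK: "M * R * K = diag_block_mat [mat_diag r (\<lambda>i. ?x powi (\<sigma> ! i)), 0\<^sub>m (m - r) (n - r)]"
    using si R unfolding structural_indices_def Let_def r[symmetric] by auto
  have Md: "det (eval_mat z M) \<noteq> 0" and Kd: "det (eval_mat z K) \<noteq> 0"
    using invertible_mat_det_nonzero[OF eval_mat_carrier[OF M(1)] M(3)]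
      invertible_mat_det_nonzero[OF eval_mat_carrier[OF K(1)] K(3)] by auto
  have MR: "M * R \<in> carrier_mat m n" and S: "M * R * K \<in> carrier_mat m n"
    using M R K by auto
  \<comment> \<open>With truncated subtraction, \<open>r + (m - r) = m\<close> amounts to
    \<open>r \<le> m\<close>; likewise for \<open>n\<close>.\<close>
  have "dim_row (M * R * K) = r + (m - r)" "dim_col (M * R * K) = r + (n - r)"
    unfolding MRK by (simp_all add: dim_diag_block_mat mat_diag_def)
  then have rm: "r \<le> m" and rn: "r \<le> n"
    using S by auto
  have Sidx: "(M * R * K) $$ (k, j) = (if k = j \<and> k < r then ?x powi (\<sigma> ! k) else 0)"
    if "k < m" "j < n" for k j
    unfolding MRK using that rm rn by (auto simp: Let_def mat_diag_def)
  have "0 < r"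
  proof (rule ccontr)
    assume "\<not> 0 < r"
    then have S0: "M * R * K = 0\<^sub>m m n"
      using S Sidx by (intro eq_matI) (auto simp del: index_mult_mat(1))
    have "det M \<noteq> 0" "det K \<noteq> 0"
      using Md Kd det_eval_mat[OF M(1,2)] det_eval_mat[OF K(1,2)] by auto
    then obtain Mi Ki where Mi: "Mi \<in> carrier_mat m m" "Mi * M = 1\<^sub>m m"
      and Ki: "Ki \<in> carrier_mat n n" "K * Ki = 1\<^sub>m n"
      using invertible_of_det_nonzero[OF M(1)] invertible_of_det_nonzero[OF K(1)] by metis
    have "M * R = M * R * K * Ki"
      using assoc_mult_mat[OF MR K(1) Ki(1)] Ki(2) right_mult_one_mat[OF MR] by simp
    also have "\<dots> = 0\<^sub>m m n"
      unfolding S0 using Ki(1) by simp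
    finally have "M * R = 0\<^sub>m m n" .
    then have "R = 0\<^sub>m m n"
      using assoc_mult_mat[OF Mi(1) M(1) R] Mi left_mult_one_mat[OF R] by simp
    then show False
      using R0 by simp
  qed
  let ?R = "?x ^ l \<cdot>\<^sub>m R"
  have R': "?R \<in> carrier_mat m n"
    using R by simp
  have "no_pole_at z (?x ^ l * R $$ (i, j))" if "i < m" "j < n" for i j
  proof (rule no_pole_at_power_mult)
    have "finite (elements_mat R)"
      by (simp add: elements_mat_def)
    then show "pole_order z (R $$ (i, j)) \<le> l"
      unfolding l pole_order_mat_def using that elements_matI[OF R] by (intro Max_ge) auto
  qed
  then have npR: "no_pole_mat z ?R"
    using R by (auto simp: no_pole_mat_iff)
  have S': "M * ?R * K = ?x ^ l \<cdot>\<^sub>m (M * R * K)"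
    using mult_smult_distrib[OF M(1) R] mult_smult_assoc_mat[OF MR K(1)] by simp
  have npS: "no_pole_mat z (M * ?R * K)"
    using no_pole_mat_mult[OF _ K(1) no_pole_mat_mult[OF M(1) R' M(2) npR] K(2)] mult_carrier_mat[OF M(1) R']
    by simp
  have xp: "?x ^ l * ?x powi (\<sigma> ! k) = ?x powi (\<sigma> ! k + int l)" for k
    by (simp add: power_int_add)
  have S'idx: "(M * ?R * K) $$ (k, j) = (if k = j \<and> k < r then ?x powi (\<sigma> ! k + int l) else 0)"
    if "k < m" "j < n" for k j
  proof -
    have "(M * ?R * K) $$ (k, j) = ?x ^ l * (M * R * K) $$ (k, j)"
      unfolding S' using S that by (intro index_smult_mat(1)) auto
    then show ?thesis
      unfolding Sidx[OF that] by (simp add: xp del: index_mult_mat)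
  qed
  have nonneg: "0 \<le> \<sigma> ! k + int l" if k: "k < r" for k
  proof -
    have km: "k < m" "k < n"
      using k rm rn by auto
    have "no_pole_at z ((M * ?R * K) $$ (k, k))"
      using npS M(1) K(1) km unfolding no_pole_mat_iff by auto
    then show ?thesis
      unfolding S'idx[OF km] using k no_pole_at_powi_shifted_var by auto
  qed
  define s where "s k = nat (\<sigma> ! k + int l)" for k
  have "M * ?R * K = Matrix.mat m n (\<lambda>(k, j). if k = j \<and> k < r then ?x ^ s k else 0)"
    using M(1) K(1) S'idx nonneg
    by (intro eq_matI) (auto simp: s_def power_int_def simp del: index_mult_mat(1))
  then show thesis
    using that[OF M(1,2) Md K(1,2) Kd _ npR rm rn \<open>0 < r\<close>, of s] nonneg by (simp add: s_def)
qed

section \<open>The factorisation obtained from a complete run\<close>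

theorem mainTheorem2:
  fixes R N Rdelta Nr Mr :: "ratfun mat"
    and L :: "complex mat"
    and z :: complex
    and m n r l :: nat
    and \<sigma> :: "int list"
    and d :: int
    and e :: "int \<Rightarrow> nat"
  assumes "R \<in> carrier_mat m n"
    and "R \<noteq> 0\<^sub>m m n"
    and "r = mat_rank R"
    and "l = pole_order_mat z R"
    and "structural_indices z R \<sigma>"
    and "d = Max (set \<sigma>)"
    and "\<And>k. e k = card {j. j < length \<sigma> \<and> \<sigma> ! j = k}"
    and "toeplitz_rank_search z (nat (d + int l)) ((shifted_var z ^ l) \<cdot>\<^sub>m R) N Rdelta L"
    and "Nr = N * lead_cols n r"
    and "Mr = Rdelta * lead_cols n r"
  shows "R * Nr = Mr * diag_block_mat
           (map (\<lambda>k. (shifted_var z powi k) \<cdot>\<^sub>m 1\<^sub>m (e k)) [- int l..d]) \<and>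
         (\<exists>P \<in> carrier_mat n n. N = map_mat to_fract P \<and> unimodular P) \<and>
         no_pole_mat z Mr \<and>
         eval_mat z Mr = L \<and>
         L \<in> carrier_mat m r \<and>
         mat_rank L = r"
proof -
  let ?x = "shifted_var z"
  let ?R = "?x ^ l \<cdot>\<^sub>m R"
  define \<delta> where "\<delta> = nat (d + int l)"
  note R = assms(1)
  have R': "?R \<in> carrier_mat m n"
    using R by simp
  obtain M K s where M: "M \<in> carrier_mat m m" "no_pole_mat z M" "det (eval_mat z M) \<noteq> 0"
    and K: "K \<in> carrier_mat n n" "no_pole_mat z K" "det (eval_mat z K) \<noteq> 0"
    and MRK: "M * ?R * K = Matrix.mat m n (\<lambda>(k, j). if k = j \<and> k < r then ?x ^ s k else 0)"
    and npR: "no_pole_mat z ?R" and rm: "r \<le> m" and rn: "r \<le> n" and r0: "0 < r"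
    and s: "\<And>k. k < r \<Longrightarrow> int (s k) = \<sigma> ! k + int l"
    by (rule structural_indices_shift[OF assms(1-5)]) (rule that)
  have len: "length \<sigma> = r" and sorted: "sorted \<sigma>"
    using assms(3,5) by (auto simp: structural_indices_def Let_def)
  have s_mono: "s j \<le> s k" if "j \<le> k" "k < r" for j k
  proof -
    have "\<sigma> ! j \<le> \<sigma> ! k"
      using that len sorted by (simp add: sorted_nth_mono)
    then have "int (s j) \<le> int (s k)"
      using s that by simp
    then show ?thesis
      by simp
  qed
  \<comment> \<open>The lower bound holds because \<open>s k\<close> is a natural number; the upper
    one is the definition of \<open>d\<close>.\<close>
  have \<sigma>_range: "\<sigma> ! k \<in> {- int l..d}" if "k < r" for k
    using that s[OF that] len by (auto simp: assms(6))
  have s_le: "s k \<le> \<delta>" if "k < r" for k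
    using \<sigma>_range[OF that] s[OF that] by (auto simp: \<delta>_def)

  obtain RR NN LL where run: "(\<forall>i \<le> \<delta>.
        toeplitz_step (eval_mat z (case_nat ?R RR i)) (case_nat 0 (\<lambda>i. dim_col (LL i)) i) (NN i) (LL i) \<and>
        RR i = case_nat ?R RR i * const_mat (NN i) *
          lead_one_diag n (dim_col (LL i)) (inverse (if i < \<delta> then ?x else 1))) \<and>
      N = mat_prod n
       (map (\<lambda>i. const_mat (NN i) * lead_one_diag n (dim_col (LL i)) (inverse (if i < \<delta> then ?x else 1))) [0..<Suc \<delta>] @
        map (\<lambda>i. lead_one_diag n (dim_col (LL i)) (if i < \<delta> then ?x else 1)) [0..<Suc \<delta>]) \<and>
      Rdelta = RR \<delta> \<and> L = LL \<delta>"
    using assms(8) unfolding toeplitz_rank_search_def Let_def \<delta>_def[symmetric] carrier_matD(2)[OF R']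
    by (elim exE) (rule that)
  have search: "toeplitz_step (eval_mat z (case_nat ?R RR i)) (case_nat 0 (\<lambda>i. dim_col (LL i)) i) (NN i) (LL i)"
    and RR: "RR i = case_nat ?R RR i * const_mat (NN i) *
        lead_one_diag n (dim_col (LL i)) (inverse (if i < \<delta> then ?x else 1))" if "i \<le> \<delta>" for i
    using run that by blast+
  note N = run[THEN conjunct2, THEN conjunct1]
  have Rdelta: "Rdelta = RR \<delta>" and L: "L = LL \<delta>"
    using run by blast+
  \<comment> \<open>\<open>A i\<close> and \<open>\<rho> i\<close> are the data entering step
    \<open>i\<close>, whereas \<open>RR i\<close> and \<open>LL i\<close> result from it.\<close>
  define A where "A = case_nat ?R RR"
  define \<rho> where "\<rho> = case_nat 0 (\<lambda>i. dim_col (LL i))"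
  define c where "c i j = (\<Sum>k<i. if j < dim_col (LL k) then 0 else 1 :: nat)" for i j
  \<comment> \<open>This differs from the factors of the run only at the last step.
    \<open>T i\<close> stops before step \<open>i\<close>, so up to \<open>T \<delta>\<close> the
    two agree.\<close>
  define \<Lambda>i where "\<Lambda>i i = lead_one_diag n (dim_col (LL i)) (inverse ?x)" for i
  define T where "T i = mat_prod n (map (\<lambda>k. const_mat (NN k) * \<Lambda>i k) [0..<i])" for i
  have step: "toeplitz_step (eval_mat z (A i)) (\<rho> i) (NN i) (LL i)" if "i \<le> \<delta>" for i
    using search[OF that] by (simp add: A_def \<rho>_def)
  have state: "search_state z ?R i (A i) (\<rho> i) (c i) (T i) \<and> (\<forall>k<i. NN k \<in> carrier_mat n n)"
    if "i \<le> \<delta>" for i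
    using that
  proof (induction i)
    case 0
    then show ?case
      using search_state_initial[OF R' npR] by (simp add: A_def \<rho>_def c_def T_def mat_prod_def)
  next
    case (Suc i)
    then have i: "i < \<delta>" and st: "search_state z ?R i (A i) (\<rho> i) (c i) (T i)"
      and NN: "\<forall>k<i. NN k \<in> carrier_mat n n"
      by auto
    note stp = step[OF less_imp_le[OF i]]
    note ss = search_state_step[OF R' st stp]
    have NNi: "\<forall>k<Suc i. NN k \<in> carrier_mat n n"
      using NN ss(5) less_Suc_eq by auto
    have Lam: "\<Lambda>i k \<in> carrier_mat n n" for k
      by (simp add: \<Lambda>i_def)
    have AS: "A (Suc i) = A i * const_mat (NN i) * \<Lambda>i i"
      using RR[of i] i by (simp add: A_def \<Lambda>i_def)
    have fac: "const_mat (NN k) * \<Lambda>i k \<in> carrier_mat n n" if "k < Suc i" for k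
      using NNi that Lam by (intro mult_carrier_mat[of _ n n]) auto
    have facs: "set (map (\<lambda>k. const_mat (NN k) * \<Lambda>i k) [0..<i]) \<subseteq> carrier_mat n n"
      using fac by (auto simp del: mult_carrier_mat)
    have Tc: "T i \<in> carrier_mat n n"
      unfolding T_def by (rule mat_prod_carrier[OF facs])
    have "T (Suc i) = T i * (const_mat (NN i) * \<Lambda>i i)"
      unfolding T_def using mat_prod_snoc[OF facs fac[OF lessI]] by simp
    also have "\<dots> = T i * const_mat (NN i) * \<Lambda>i i"
      using ss(5) Tc Lam by (intro assoc_mult_mat[symmetric]) auto
    finally have TS: "T (Suc i) = T i * const_mat (NN i) * \<Lambda>i i" .
    have cS: "c (Suc i) = (\<lambda>j. c i j + (if j < dim_col (LL i) then 0 else 1))"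
      by (auto simp: c_def)
    show ?case
      using search_state_Suc[OF R' st stp] NNi R by (simp add: AS TS cS \<rho>_def \<Lambda>i_def)
  qed
  have dim_LL: "j < dim_col (LL i) \<longleftrightarrow> s j \<le> i" if i: "i \<le> \<delta>" and j: "j < r" for i j
  proof -
    obtain q where q: "q \<le> r" "\<And>k. k < r \<Longrightarrow> s k \<le> i \<longleftrightarrow> k < q"
      by (rule threshold_index[of r s i]) (use s_mono that in blast)+
    have "dim_col (LL i) = q"
      using search_state_dim_col[OF R' conjunct1[OF state[OF i]] step[OF i] M K MRK rm rn q] .
    then show ?thesis
      using q(2)[OF j] by simp
  qed
  \<comment> \<open>The choice of \<delta> matters here: every shifted index is at most \<delta>, so
    the threshold of the last step is \<open>r\<close>.\<close>
  have dimL: "dim_col L = r"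
  proof -
    obtain q where q: "q \<le> r" "\<And>k. k < r \<Longrightarrow> s k \<le> \<delta> \<longleftrightarrow> k < q"
      by (rule threshold_index[of r s \<delta>]) (use s_mono that in blast)+
    have "dim_col (LL \<delta>) = q"
      using search_state_dim_col[OF R' conjunct1[OF state[OF order_refl]] step[OF order_refl] M K MRK rm rn q] .
    moreover have "q = r"
      using q(1) q(2)[of q] s_le[of q] by (cases "q < r") auto
    ultimately show ?thesis
      by (simp add: L)
  qed
  \<comment> \<open>Column \<open>j\<close> is divided at step \<open>k\<close> exactly while
    \<open>k < s j\<close>. The last step divides nothing, so the count runs below \<delta>;
    \<open>s j \<le> \<delta>\<close> ensures that it reaches \<open>s j\<close>.\<close>
  have c\<delta>: "c \<delta> j = s j" if j: "j < r" for j
  proof -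
    have "c \<delta> j = (\<Sum>k<\<delta>. if k < s j then 1 else 0)"
      unfolding c_def using dim_LL[OF _ j] by (intro sum.cong) auto
    also have "\<dots> = card {k. k < \<delta> \<and> k < s j}"
      by (simp add: sum.If_cases Collect_conj_eq lessThan_def)
    also have "{k. k < \<delta> \<and> k < s j} = {..<s j}"
      using s_le[OF j] by auto
    finally show ?thesis
      by simp
  qed
  note st = state[OF order_refl, THEN conjunct1] and NNc = state[OF order_refl, THEN conjunct2]
  note fin = search_state_step[OF R' st step[OF order_refl]]
  let ?B = "A \<delta> * const_mat (NN \<delta>)" and ?D = "mat_diag n (\<lambda>j. ?x ^ c \<delta> j)"
  have B: "Rdelta = ?B"
    using RR[of \<delta>] right_mult_one_mat[OF fin(6)] by (simp add: Rdelta A_def)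
  \<comment> \<open>Both diagonal factors of the last step are identities. What remains is the
    matrix that the half step of the invariant shows to be unimodular.\<close>
  have ND: "N = T \<delta> * const_mat (NN \<delta>) * ?D"
  proof -
    let ?F = "\<lambda>i. const_mat (NN i) * lead_one_diag n (dim_col (LL i)) (inverse (if i < \<delta> then ?x else 1))"
    let ?G = "\<lambda>i. lead_one_diag n (dim_col (LL i)) (if i < \<delta> then ?x else 1)"
    have NNall: "NN k \<in> carrier_mat n n" if "k < Suc \<delta>" for k
      using NNc fin(5) that by (cases "k = \<delta>") auto
    have F: "set (map ?F [0..<Suc \<delta>]) \<subseteq> carrier_mat n n" "set (map ?F [0..<\<delta>]) \<subseteq> carrier_mat n n"
      using NNall by (auto intro!: mult_carrier_mat[of _ n n] simp del: upt_Suc)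
    have G: "set (map ?G [0..<Suc \<delta>]) \<subseteq> carrier_mat n n" "set (map ?G [0..<\<delta>]) \<subseteq> carrier_mat n n"
      by auto
    have F\<delta>: "?F \<delta> = const_mat (NN \<delta>)"
      using right_mult_one_mat[of "const_mat (NN \<delta>)" n n] fin(5) by simp
    have "mat_prod n (map ?F [0..<Suc \<delta>]) = mat_prod n (map ?F [0..<\<delta>]) * ?F \<delta>"
      using mat_prod_snoc[OF F(2), of "?F \<delta>"] fin(5) F\<delta> by simp
    also have "map ?F [0..<\<delta>] = map (\<lambda>k. const_mat (NN k) * \<Lambda>i k) [0..<\<delta>]"
      by (auto simp: \<Lambda>i_def)
    finally have PF: "mat_prod n (map ?F [0..<Suc \<delta>]) = T \<delta> * const_mat (NN \<delta>)"
      unfolding F\<delta> T_def .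
    have "mat_prod n (map ?G [0..<Suc \<delta>]) = mat_prod n (map ?G [0..<\<delta>]) * 1\<^sub>m n"
      using mat_prod_snoc[OF G(2), of "?G \<delta>"] by simp
    also have "\<dots> = mat_prod n (map ?G [0..<\<delta>])"
      by (rule right_mult_one_mat[OF mat_prod_carrier[OF G(2)]])
    also have "map ?G [0..<\<delta>] = map (\<lambda>k. lead_one_diag n (dim_col (LL k)) ?x) [0..<\<delta>]"
      by auto
    finally have PG: "mat_prod n (map ?G [0..<Suc \<delta>]) = ?D"
      unfolding mat_prod_lead_one_diag c_def .
    show ?thesis
      unfolding N mat_prod_append[OF F(1) G(1)] PF PG ..
  qed
  obtain P where P: "P \<in> carrier_mat n n" "unimodular P" "N = map_mat to_fract P"
    using fin(11) ND by auto
  have Nc: "N \<in> carrier_mat n n"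
    using P by simp
  have RN: "?x ^ l \<cdot>\<^sub>m (R * N) = Rdelta * ?D"
  proof -
    have "?x ^ l \<cdot>\<^sub>m (R * N) = ?R * N"
      by (rule mult_smult_assoc_mat[OF R Nc, symmetric])
    also have "\<dots> = ?R * (T \<delta> * const_mat (NN \<delta>)) * ?D"
      unfolding ND by (rule assoc_mult_mat[OF R' fin(9) mat_diag_dim, symmetric])
    finally show ?thesis
      unfolding B fin(10) .
  qed
  have Bc: "Rdelta \<in> carrier_mat m n"
    unfolding B by (rule fin(6))
  \<comment> \<open>Cancelling \<open>?x ^ l\<close> turns the exponent \<open>s j\<close> into
    \<open>\<sigma> ! j\<close>, which may be negative, hence \<open>powi\<close>. The columns kept
    by \<open>lead_cols\<close> are those with \<open>j < r\<close>, where the exponents are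
    known.\<close>
  have RNidx: "(R * N) $$ (i, j) = Rdelta $$ (i, j) * ?x powi (\<sigma> ! j)" if ij: "i < m" "j < r" for i j
  proof -
    have jn: "j < n"
      using ij rn by simp
    have xs: "?x ^ s j = ?x ^ l * ?x powi (\<sigma> ! j)"
    proof -
      have "?x ^ s j = ?x powi (int (s j))"
        by simp
      also have "\<dots> = ?x powi (\<sigma> ! j) * ?x powi (int l)"
        unfolding s[OF ij(2)] by (rule power_int_add) simp
      finally show ?thesis
        by (simp add: mult.commute)
    qed
    have "?x ^ l * (R * N) $$ (i, j) = (?x ^ l \<cdot>\<^sub>m (R * N)) $$ (i, j)"
      using R Nc ij jn by simp
    also have "\<dots> = Rdelta $$ (i, j) * ?x ^ c \<delta> j"
      unfolding RN using ij jn by (simp add: mat_diag_mult_right[OF Bc])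
    also have "\<dots> = ?x ^ l * (Rdelta $$ (i, j) * ?x powi (\<sigma> ! j))"
      unfolding c\<delta>[OF ij(2)] xs by (simp only: mult_ac)
    finally show ?thesis
      by (simp del: index_mult_mat)
  qed
  have Mr: "Mr = Matrix.mat m r (($$) Rdelta)"
    unfolding assms(10) by (rule mult_lead_cols[OF Bc rn])
  then have Mrc: "Mr \<in> carrier_mat m r"
    by simp
  have blocks: "diag_block_mat (map (\<lambda>k. (?x powi k) \<cdot>\<^sub>m 1\<^sub>m (e k)) [- int l..d])
      = mat_diag r (\<lambda>j. ?x powi (\<sigma> ! j))"
  proof -
    have "set \<sigma> \<subseteq> {- int l..d}"
      using \<sigma>_range len by (auto simp: in_set_conv_nth)
    then have "concat (map (\<lambda>k. replicate (e k) k) [- int l..d]) = \<sigma>"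
      using concat_replicate_sorted[OF sorted _ assms(7)] by blast
    then have "map (\<lambda>k. ?x powi k) (concat (map (\<lambda>k. replicate (e k) k) [- int l..d])) = map (\<lambda>k. ?x powi k) \<sigma>"
      by simp
    then have "concat (map (\<lambda>k. replicate (e k) (?x powi k)) [- int l..d]) = map (\<lambda>k. ?x powi k) \<sigma>"
      by (simp add: map_concat o_def)
    then show ?thesis
      unfolding diag_block_mat_scalar_blocks Let_def using len by (auto simp: mat_diag_def)
  qed
  have "R * Nr = R * N * lead_cols n r"
    unfolding assms(9)
    by (rule assoc_mult_mat[OF R Nc, symmetric, of _ r])
      (use rn carrier_append_rows[of "1\<^sub>m r :: ratfun mat" r r "0\<^sub>m (n - r) r" "n - r"] in \<open>simp add: lead_cols_def\<close>)
  also have "\<dots> = Matrix.mat m r (($$) (R * N))"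
    by (rule mult_lead_cols[OF mult_carrier_mat[OF R Nc] rn])
  also have "\<dots> = Mr * mat_diag r (\<lambda>j. ?x powi (\<sigma> ! j))"
    unfolding mat_diag_mult_right[OF Mrc] using RNidx
    by (intro eq_matI) (auto simp: Mr simp del: index_mult_mat)
  finally have 1: "R * Nr = Mr * mat_diag r (\<lambda>j. ?x powi (\<sigma> ! j))" .
  have npMr: "no_pole_mat z Mr"
  proof (rule no_pole_matI[OF Mrc])
    show "no_pole_at z (Mr $$ (i, j))" if "i < m" "j < r" for i j
      using no_pole_matD[OF fin(7,6), of i j] that rn by (simp add: Mr B del: index_mult_mat)
  qed
  have Lc: "L \<in> carrier_mat m r"
    using fin(3) unfolding L[symmetric] dimL .
  have eval: "eval_mat z Mr = L"
  proof (rule eq_matI)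
    fix i j assume "i < dim_row L" "j < dim_col L"
    then have ij: "i < m" "j < r" and jn: "j < n"
      using Lc rn by auto
    have "eval_mat z Mr $$ (i, j) = eval_mat z Rdelta $$ (i, j)"
      using ij jn Bc by (simp add: Mr)
    also have "\<dots> = L $$ (i, j)"
      unfolding B fin(8) using ij jn fin(2) dimL append_cols_index[OF fin(3) zero_carrier_mat, of i j]
      by (simp add: L)
    finally show "eval_mat z Mr $$ (i, j) = L $$ (i, j)" .
  qed (use Lc Mrc in auto)
  have "mat_rank L = r"
    using mat_rank_eq_dim_col_iff[OF Lc] fin(4) by (simp add: L)
  then show ?thesis
    unfolding blocks using 1 P npMr eval Lc by blast
qed

end
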